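(* Let $1\rightarrow A \rightarrow G \rightarrow K \rightarrow 1$ be a central extension of finite groups (a short exact sequence in which the image of $A$ is contained in $Z(G)$), with $A$ nontrivial and $K$ centerless. Then $G$ is stable if and only if $G\cong C_2 \times K$, $K$ is complete, and $K^{\mathrm{ab}}$ has a nontrivial cyclic Sylow $2$-subgroup.
   Context: All groups are finite. A group $G$ is stable if $G\cong \operatorname{Aut}(G)$ (abstractly isomorphic). A group $K$ is centerless if $Z(K)$ is trivial. A group $K$ is complete if the conjugation map $c:K\rightarrow \operatorname{Aut}(K)$, $c(g)=c_g$ with $c_g(x)=gxg^{-1}$, is an isomorphism. $C_n$ denotes the cyclic group of order $n$, and $K^{\mathrm{ab}}=K/K'$ is the abelianization of $K$, where $K'$ is the derived subgroup. *)

theory Defs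
  imports "HOL-Algebra.Algebra" "HOL-Computational_Algebra.Primes"
begin

definition center :: "('a, 'm) monoid_scheme \<Rightarrow> 'a set"
  where "center G = {z \<in> carrier G. \<forall>x \<in> carrier G. z \<otimes>\<^bsub>G\<^esub> x = x \<otimes>\<^bsub>G\<^esub> z}"

definition centerless :: "('a, 'm) monoid_scheme \<Rightarrow> bool"
  where "centerless G \<longleftrightarrow> center G = {\<one>\<^bsub>G\<^esub>}"

text \<open>
  \<open>1 \<rightarrow> A \<rightarrow> G \<rightarrow> K \<rightarrow> 1\<close> with maps \<open>i\<close> and \<open>p\<close>. The library's \<^const>\<open>short_exact_sequence\<close> forces
  the three groups to live on the same type, so exactness is written out here; on a common type
  it is \<open>short_exact_sequence K G A p i\<close> (the library lists the groups from right to left).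
\<close>

definition central_extension ::
  "('a, 'm) monoid_scheme \<Rightarrow> ('g, 'n) monoid_scheme \<Rightarrow> ('k, 'l) monoid_scheme
    \<Rightarrow> ('a \<Rightarrow> 'g) \<Rightarrow> ('g \<Rightarrow> 'k) \<Rightarrow> bool"
  where "central_extension A G K i p \<longleftrightarrow>
    group A \<and> group G \<and> group K \<and>
    i \<in> mon A G \<and> p \<in> epi G K \<and> i ` carrier A = kernel G K p \<and>
    i ` carrier A \<subseteq> center G"

definition stable_group :: "('a, 'm) monoid_scheme \<Rightarrow> bool"
  where "stable_group G \<longleftrightarrow> G \<cong> AutoGroup G"

text \<open>
  Elements of \<^const>\<open>AutoGroup\<close> are extensional functions, hence the restriction in the
  conjugation map.
\<close>

definition conjugation :: "('a, 'm) monoid_scheme \<Rightarrow> 'a \<Rightarrow> 'a \<Rightarrow> 'a"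
  where "conjugation G g = (\<lambda>x \<in> carrier G. g \<otimes>\<^bsub>G\<^esub> x \<otimes>\<^bsub>G\<^esub> inv\<^bsub>G\<^esub> g)"

definition complete_group :: "('a, 'm) monoid_scheme \<Rightarrow> bool"
  where "complete_group G \<longleftrightarrow> conjugation G \<in> iso G (AutoGroup G)"

definition abelianization :: "('a, 'm) monoid_scheme \<Rightarrow> 'a set monoid"
  where "abelianization G = G Mod (derived G (carrier G))"

text \<open>For finite \<open>G\<close> only: \<^term>\<open>order G\<close> is 0 otherwise.\<close>

definition sylow_subgroup :: "nat \<Rightarrow> 'a set \<Rightarrow> ('a, 'm) monoid_scheme \<Rightarrow> bool"
  where "sylow_subgroup p P G \<longleftrightarrow> Factorial_Ring.prime p \<and> subgroup P G \<and> card P = p ^ multiplicity p (order G)"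

end

theory Submission
  imports Defs
begin

text \<open>
Write \<open>L\<close> for the automorphism group of \<open>G\<close>. Since \<open>K\<close> is centerless, \<open>A\<close> is identified with the
center of \<open>G\<close>, and \<open>K\<close> with the group of inner automorphisms.

Suppose that \<open>G\<close> is isomorphic to \<open>L\<close>. Then the center of \<open>L\<close> has \<open>\<bar>A\<bar>\<close> elements. It commutes with the
inner automorphisms and meets them trivially, because they form a centerless group; by counting,
\<open>L\<close> is the direct product of these two subgroups (\<open>automorphism_decomposition\<close>). So \<open>G\<close> is
isomorphic to \<open>A \<times> K\<close>, and one may assume \<open>G = A \<times> K\<close>. The center of \<open>L\<close> now consists of the
automorphisms that act trivially on \<open>K\<close> (\<open>center_L_iff\<close>), and this has strong consequences.
An automorphism of \<open>K\<close> extends to \<open>G\<close>, and modulo the center of \<open>L\<close> it is inner, so \<open>K\<close> is complete.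
The automorphisms of \<open>A\<close> embed into the abelian center of \<open>L\<close>, and an abelian group whose
automorphisms commute is cyclic (\<open>cyclic_if_automorphisms_commute\<close>). A homomorphism \<open>f\<close> from \<open>K\<close> to
\<open>A\<close> gives the central automorphism \<open>(a, k) \<mapsto> (a f(k), k)\<close>. If all such \<open>f\<close> were trivial, the
center of \<open>L\<close> would be the automorphism group of a nontrivial cyclic group of order \<open>\<bar>A\<bar>\<close>, which is
too small. If \<open>f\<close> is nontrivial, commuting with the inversion of \<open>A\<close> makes its automorphism an
involution. But the center of \<open>L\<close> is isomorphic to the cyclic group \<open>A\<close> and has at most one involution.
Hence \<open>f\<close> is unique and the inversion of \<open>A\<close> is the identity, so that \<open>A\<close> has order two.

Conversely, for complete \<open>K\<close> with exactly one nontrivial homomorphism \<open>f\<close> onto the group of order two, the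
automorphisms of \<open>C\<^sub>2 \<times> K\<close> are the maps \<open>(a, x) \<mapsto> (a + c f(x), k x k\<^sup>-\<^sup>1)\<close>, and they multiply
like the pairs \<open>(c, k)\<close> (\<open>stable_Z2_product\<close>).

Finally, homomorphisms to the group of order two factor through the abelianization, and a finite abelian
group has exactly one nontrivial such homomorphism if and only if its Sylow 2-subgroup is cyclic and
nontrivial (\<open>unique_hom_Z2_iff_cyclic_Sylow\<close>). Both this and the criterion for cyclicity rest on the
extension of characters from subgroups (\<open>extend_hom\<close>), which takes the place of the structure
theorem for finite abelian groups.
\<close>

section \<open>Extending homomorphisms between abelian groups\<close>

lemma hom_through_epi:
  assumes "group G" "group Q" "group T"
    and p: "p \<in> epi G Q" and f: "f \<in> hom G T"
    and ker: "\<And>x. x \<in> carrier G \<Longrightarrow> p x = \<one>\<^bsub>Q\<^esub> \<Longrightarrow> f x = \<one>\<^bsub>T\<^esub>"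
  obtains f' where "f' \<in> hom Q T" "\<And>x. x \<in> carrier G \<Longrightarrow> f' (p x) = f x"
proof -
  interpret P: group_hom G Q p
    using assms by (simp add: group_hom_def group_hom_axioms_def epi_def)
  interpret F: group_hom G T f
    using assms by (simp add: group_hom_def group_hom_axioms_def)
  have surj: "p ` carrier G = carrier Q"
    using p by (simp add: epi_def)
  have eq: "f x = f y" if "x \<in> carrier G" "y \<in> carrier G" "p x = p y" for x y
  proof -
    have "f (x \<otimes>\<^bsub>G\<^esub> inv\<^bsub>G\<^esub> y) = \<one>\<^bsub>T\<^esub>"
      using that by (intro ker) auto
    then have "f x \<otimes>\<^bsub>T\<^esub> inv\<^bsub>T\<^esub> f y = \<one>\<^bsub>T\<^esub>"
      using that by simp
    then show ?thesis
      using that by (metis F.H.inv_equality F.H.inv_inv F.H.inv_closed F.hom_closed)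
  qed
  define f' where "f' q = f (inv_into (carrier G) p q)" for q
  have f': "f' (p x) = f x" if "x \<in> carrier G" for x
    unfolding f'_def
    by (rule eq) (use that in \<open>auto intro: inv_into_into f_inv_into_f\<close>)
  have "f' \<in> hom Q T"
  proof (rule homI)
    fix u assume "u \<in> carrier Q"
    then show "f' u \<in> carrier T"
      using surj f' by (metis F.hom_closed imageE)
  next
    fix u v assume "u \<in> carrier Q" "v \<in> carrier Q"
    then obtain x y where "x \<in> carrier G" "u = p x" "y \<in> carrier G" "v = p y"
      using surj by (metis imageE)
    then show "f' (u \<otimes>\<^bsub>Q\<^esub> v) = f' u \<otimes>\<^bsub>T\<^esub> f' v"
      using f' by (metis F.hom_mult P.G.m_closed P.hom_mult)
  qed
  then show ?thesis using f' that by blast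
qed

text \<open>
The exponents carrying \<open>x\<close> into a subgroup form an ideal of the integers; \<open>k\<close> generates it.
\<close>

lemma (in group) relative_order:
  assumes S: "subgroup S G" and x: "x \<in> carrier G" and n: "0 < n" "x [^] (n::nat) \<in> S"
  obtains k where "0 < k" "x [^] (k::nat) \<in> S" "\<And>j::int. x [^] j \<in> S \<Longrightarrow> int k dvd j"
proof -
  define k where "k = (LEAST k. 0 < k \<and> x [^] (k::nat) \<in> S)"
  have k: "0 < k" "x [^] k \<in> S"
    using LeastI[of "\<lambda>k. 0 < k \<and> x [^] (k::nat) \<in> S" n] n by (auto simp: k_def)
  have "int k dvd j" if j: "x [^] (j::int) \<in> S" for j
  proof -
    have "x [^] (j mod int k) = x [^] (j - int k * (j div int k))"
      by (simp add: minus_mult_div_eq_mod)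
    also have "\<dots> = x [^] j \<otimes> inv ((x [^] k) [^] (j div int k))"
      using x by (simp add: int_pow_diff int_pow_pow flip: int_pow_int)
    also have "\<dots> \<in> S"
      using S j k by (meson subgroup.m_closed subgroup.m_inv_closed subgroup_int_pow_closed)
    finally have "x [^] nat (j mod int k) \<in> S"
      using k by (simp flip: int_pow_int)
    moreover have "nat (j mod int k) < k" using k by (simp add: nat_less_iff)
    ultimately have "\<not> 0 < nat (j mod int k)"
      using not_less_Least[of "nat (j mod int k)" "\<lambda>k. 0 < k \<and> x [^] (k::nat) \<in> S"] by (auto simp: k_def)
    moreover have "0 \<le> j mod int k" using k by simp
    ultimately have "j mod int k = 0" by linarith
    then show ?thesis by auto
  qed
  with k show ?thesis using that by blast
qed

text \<open>
To send a new element \<open>x\<close> to \<open>w\<close>, the only obstruction is the relation that \<open>x\<close> satisfies over \<open>S\<close>,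
namely that its \<open>k\<close>-th power lies there. The extension is obtained by factoring the obvious map
on \<open>S \<times> \<int>\<close> through \<open>(s, j) \<mapsto> s x\<^sup>j\<close>, whose kernel is governed by that single relation.
\<close>

lemma extend_hom_by_one_element:
  assumes "comm_group G" "comm_group B"
    and S: "subgroup S G" and chi: "chi \<in> hom (G\<lparr>carrier := S\<rparr>) B"
    and x: "x \<in> carrier G" and w: "w \<in> carrier B"
    and k: "x [^]\<^bsub>G\<^esub> (k::nat) \<in> S" "\<And>j::int. x [^]\<^bsub>G\<^esub> j \<in> S \<Longrightarrow> int k dvd j"
    and wk: "w [^]\<^bsub>B\<^esub> k = chi (x [^]\<^bsub>G\<^esub> k)"
  obtains T chi' where "subgroup T G" "S \<subseteq> T" "x \<in> T" "chi' \<in> hom (G\<lparr>carrier := T\<rparr>) B"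
    "\<And>s. s \<in> S \<Longrightarrow> chi' s = chi s" "chi' x = w"
proof -
  interpret G: comm_group G by fact
  interpret B: comm_group B by fact
  interpret S: subgroup S G by fact
  let ?S = "G\<lparr>carrier := S\<rparr>"
  interpret GS: group ?S using S G.subgroup_imp_group by blast
  interpret chi: group_hom ?S B chi
    using chi by (simp add: group_hom_def group_hom_axioms_def)
  let ?D = "?S \<times>\<times> integer_group"
  define p where "p = (\<lambda>(s, j::int). s \<otimes>\<^bsub>G\<^esub> x [^]\<^bsub>G\<^esub> j)"
  define f where "f = (\<lambda>(s, j::int). chi s \<otimes>\<^bsub>B\<^esub> w [^]\<^bsub>B\<^esub> j)"
  define T where "T = p ` carrier ?D"
  have D: "group ?D" by (simp add: DirProd_group)
  have pG: "p \<in> hom ?D G"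
    using x by (auto simp: p_def intro!: homI) (simp add: G.int_pow_mult G.m_ac)
  have T: "subgroup T G"
    unfolding T_def using group_hom.img_is_subgroup[of ?D G p] D pG
    by (simp add: group_hom_def group_hom_axioms_def)
  have pT: "p \<in> epi ?D (G\<lparr>carrier := T\<rparr>)"
    using pG by (auto simp: epi_def T_def hom_def)
  have f: "f \<in> hom ?D B"
    using w chi.hom_mult chi.hom_closed
    by (auto simp: f_def intro!: homI) (simp add: B.int_pow_mult B.m_ac)
  have ker: "f d = \<one>\<^bsub>B\<^esub>" if d: "d \<in> carrier ?D" and pd: "p d = \<one>\<^bsub>G\<lparr>carrier := T\<rparr>\<^esub>" for d
  proof -
    obtain s j where sj: "d = (s, j)" "s \<in> S" using d by auto
    then have 1: "s \<otimes>\<^bsub>G\<^esub> x [^]\<^bsub>G\<^esub> j = \<one>\<^bsub>G\<^esub>" using pd by (simp add: p_def)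
    then have s: "s = inv\<^bsub>G\<^esub> (x [^]\<^bsub>G\<^esub> j)"
      using sj x by (metis G.inv_equality G.int_pow_closed S.mem_carrier)
    then have "x [^]\<^bsub>G\<^esub> j \<in> S" using sj x by (metis G.inv_inv G.int_pow_closed S.m_inv_closed)
    then obtain t where t: "j = int k * t" using k(2) by blast
    have "x [^]\<^bsub>G\<^esub> j = (x [^]\<^bsub>G\<^esub> k) [^]\<^bsub>?S\<^esub> t"
      using k(1) x S by (simp add: t G.int_pow_pow G.subgroup_imp_group
          flip: int_pow_int G.int_pow_consistent)
    then have "chi (x [^]\<^bsub>G\<^esub> j) = chi (x [^]\<^bsub>G\<^esub> k) [^]\<^bsub>B\<^esub> t"
      using k(1) by (simp add: chi.hom_int_pow)
    also have "\<dots> = w [^]\<^bsub>B\<^esub> j"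
      unfolding wk[symmetric] t using w by (simp add: B.int_pow_pow flip: int_pow_int)
    finally have cj: "chi (x [^]\<^bsub>G\<^esub> j) = w [^]\<^bsub>B\<^esub> j" .
    have "s = inv\<^bsub>?S\<^esub> (x [^]\<^bsub>G\<^esub> j)"
      using s G.m_inv_consistent[OF S \<open>x [^]\<^bsub>G\<^esub> j \<in> S\<close>] by simp
    then have "chi s = inv\<^bsub>B\<^esub> (w [^]\<^bsub>B\<^esub> j)"
      using \<open>x [^]\<^bsub>G\<^esub> j \<in> S\<close> cj by simp
    then show ?thesis using w by (simp add: f_def sj)
  qed
  obtain chi' where chi': "chi' \<in> hom (G\<lparr>carrier := T\<rparr>) B" "\<And>d. d \<in> carrier ?D \<Longrightarrow> chi' (p d) = f d"
    using hom_through_epi[OF D G.subgroup_imp_group[OF T] B.is_group pT f ker] by blast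
  have e: "p (s, 0) = s" "f (s, 0) = chi s" if "s \<in> S" for s
    using that chi.hom_closed by (auto simp: p_def f_def)
  have ex: "p (\<one>\<^bsub>G\<^esub>, 1) = x" "f (\<one>\<^bsub>G\<^esub>, 1) = w"
    using x w chi.hom_one by (auto simp: p_def f_def)
  show ?thesis
  proof (rule that[OF T _ _ chi'(1)])
    show "S \<subseteq> T" using e by (force simp: T_def)
    show "x \<in> T" using ex by (force simp: T_def)
    show "chi' s = chi s" if "s \<in> S" for s using chi'(2)[of "(s,0)"] e that by simp
    show "chi' x = w" using chi'(2)[of "(\<one>\<^bsub>G\<^esub>,1)"] ex by simp
  qed
qed

text \<open>
A homomorphism into a sufficiently divisible target extends to the whole group: adding one element
\<open>x\<close> at a time, the required \<open>k\<close>-th root of \<open>chi (x\<^sup>k)\<close> exists because \<open>k\<close> divides \<open>e\<close> and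
\<open>chi\<close> kills \<open>x\<^sup>e\<close>. The hypothesis that every \<open>e\<close>-th power lies in \<open>S\<close> and is killed by \<open>chi\<close>
holds when \<open>e\<close> is an exponent of the group, and also for \<open>e = 2\<close> and a trivial \<open>chi\<close> if \<open>S\<close> contains
all squares.
\<close>

lemma extend_hom:
  assumes "comm_group G" "finite (carrier G)" "comm_group B" "0 < (e::nat)"
    and roots: "\<And>k b. \<lbrakk>k dvd e; b \<in> carrier B; b [^]\<^bsub>B\<^esub> (e div k) = \<one>\<^bsub>B\<^esub>\<rbrakk> \<Longrightarrow> \<exists>w\<in>carrier B. w [^]\<^bsub>B\<^esub> k = b"
    and "subgroup S G" "chi \<in> hom (G\<lparr>carrier := S\<rparr>) B"
    and "\<And>a. a \<in> carrier G \<Longrightarrow> a [^]\<^bsub>G\<^esub> e \<in> S \<and> chi (a [^]\<^bsub>G\<^esub> e) = \<one>\<^bsub>B\<^esub>"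
  obtains chi' where "chi' \<in> hom G B" "\<And>s. s \<in> S \<Longrightarrow> chi' s = chi s"
  using assms(6-)
proof (induction "card (carrier G - S)" arbitrary: S chi thesis rule: less_induct)
  case less
  interpret G: comm_group G by fact
  interpret B: comm_group B by fact
  note S = \<open>subgroup S G\<close> and chi = \<open>chi \<in> hom (G\<lparr>carrier := S\<rparr>) B\<close>
  interpret S: subgroup S G by fact
  interpret GS: group "G\<lparr>carrier := S\<rparr>" using S G.subgroup_imp_group by blast
  interpret chi: group_hom "G\<lparr>carrier := S\<rparr>" B chi
    using chi by (simp add: group_hom_def group_hom_axioms_def)
  show ?case
  proof (cases "S = carrier G")
    case True
    then show ?thesis using less.prems(1)[of chi] chi by simp
  next
    case False
    then obtain x where x: "x \<in> carrier G" "x \<notin> S" using S.subset by blast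
    obtain k where k: "0 < k" "x [^]\<^bsub>G\<^esub> (k::nat) \<in> S" "\<And>j::int. x [^]\<^bsub>G\<^esub> j \<in> S \<Longrightarrow> int k dvd j"
      using G.relative_order[OF S x(1) \<open>0 < e\<close>] less.prems(4) x by blast
    have ke: "k dvd e"
      using k(3)[of "int e"] less.prems(4)[OF x(1)] by (simp add: int_pow_int)
    have "chi (x [^]\<^bsub>G\<^esub> k) [^]\<^bsub>B\<^esub> (e div k) = chi ((x [^]\<^bsub>G\<^esub> k) [^]\<^bsub>G\<lparr>carrier := S\<rparr>\<^esub> (e div k))"
      using k(2) by (simp add: chi.hom_nat_pow)
    also have "(x [^]\<^bsub>G\<^esub> k) [^]\<^bsub>G\<lparr>carrier := S\<rparr>\<^esub> (e div k) = x [^]\<^bsub>G\<^esub> e"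
      using k(2) x ke by (simp add: G.nat_pow_pow flip: G.nat_pow_consistent)
    finally have "chi (x [^]\<^bsub>G\<^esub> k) [^]\<^bsub>B\<^esub> (e div k) = \<one>\<^bsub>B\<^esub>"
      using less.prems(4) x by simp
    moreover have "chi (x [^]\<^bsub>G\<^esub> k) \<in> carrier B" using chi.hom_closed k(2) by simp
    ultimately obtain w where w: "w \<in> carrier B" "w [^]\<^bsub>B\<^esub> k = chi (x [^]\<^bsub>G\<^esub> k)"
      using roots ke by blast
    obtain T chi' where T: "subgroup T G" "S \<subseteq> T" "x \<in> T" "chi' \<in> hom (G\<lparr>carrier := T\<rparr>) B"
      "\<And>s. s \<in> S \<Longrightarrow> chi' s = chi s"
      using extend_hom_by_one_element[OF assms(1,3) S chi x(1) w(1) k(2,3) w(2)] by metis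
    have "card (carrier G - T) < card (carrier G - S)"
      by (rule psubset_card_mono) (use assms(2) T x in auto)
    from less.hyps[OF this _ T(1,4)] show ?thesis
      using less.prems(1,4) T(2,5) by (metis subsetD)
  qed
qed

lemma integer_mod_group_roots:
  assumes "0 < e" "k dvd e" "b \<in> carrier (integer_mod_group e)"
    and "b [^]\<^bsub>integer_mod_group e\<^esub> (e div k) = \<one>\<^bsub>integer_mod_group e\<^esub>"
  shows "\<exists>w\<in>carrier (integer_mod_group e). w [^]\<^bsub>integer_mod_group e\<^esub> k = b"
proof -
  obtain m where m: "e = k * m" using \<open>k dvd e\<close> by blast
  with \<open>0 < e\<close> have pos: "0 < k" "0 < m" by auto
  have "int e dvd int m * b" using assms(4) m pos by (simp add: mod_eq_0_iff_dvd)
  then have "int m * int k dvd int m * b" by (simp add: m mult.commute)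
  then obtain t where "b = int k * t" using pos by auto
  then have "(t mod int e) [^]\<^bsub>integer_mod_group e\<^esub> k = b"
    using assms(1,3) by (simp add: carrier_integer_mod_group mod_mult_right_eq)
  then show ?thesis
    using \<open>0 < e\<close> by (intro bexI[of _ "t mod int e"]) (auto simp: carrier_integer_mod_group)
qed

text \<open>
These are the characters of \<open>G\<close> modulo \<open>S\<close>: an element of order \<open>k\<close> modulo \<open>S\<close> can be sent to
an element of order \<open>k\<close>. In particular every element outside \<open>S\<close> is detected.
\<close>

lemma separating_character:
  assumes "comm_group G" "finite (carrier G)" "subgroup S G" "0 < (e::nat)"
    and exp: "\<And>a. a \<in> carrier G \<Longrightarrow> a [^]\<^bsub>G\<^esub> e \<in> S"
    and x: "x \<in> carrier G" and k: "x [^]\<^bsub>G\<^esub> (k::nat) \<in> S" "\<And>j::int. x [^]\<^bsub>G\<^esub> j \<in> S \<Longrightarrow> int k dvd j"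
  obtains chi where "chi \<in> hom G (integer_mod_group e)" "\<And>s. s \<in> S \<Longrightarrow> chi s = 0"
    "chi x = int (e div k) mod int e"
proof -
  interpret G: comm_group G by fact
  interpret S: subgroup S G by fact
  let ?B = "integer_mod_group e"
  have B: "comm_group ?B" by simp
  have ke: "k dvd e" using k(2)[of "int e"] exp[OF x] by (simp add: int_pow_int)
  let ?w = "int (e div k) mod int e"
  have w: "?w \<in> carrier ?B" using \<open>0 < e\<close> by (simp add: carrier_integer_mod_group)
  have "?w [^]\<^bsub>?B\<^esub> k = (\<lambda>_. 0) (x [^]\<^bsub>G\<^esub> k)"
    using ke \<open>0 < e\<close> by (simp add: mod_mult_right_eq flip: of_nat_mult)
  moreover have "(\<lambda>_. 0) \<in> hom (G\<lparr>carrier := S\<rparr>) ?B" by (auto simp: hom_def)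
  ultimately obtain T chi where T: "subgroup T G" "S \<subseteq> T" "x \<in> T" "chi \<in> hom (G\<lparr>carrier := T\<rparr>) ?B"
      and chi: "\<And>s. s \<in> S \<Longrightarrow> chi s = 0" "chi x = ?w"
    using extend_hom_by_one_element[OF assms(1) B assms(3) _ x w k] by metis
  have "a [^]\<^bsub>G\<^esub> e \<in> T \<and> chi (a [^]\<^bsub>G\<^esub> e) = \<one>\<^bsub>?B\<^esub>" if "a \<in> carrier G" for a
    using exp[OF that] T(2) chi by auto
  then obtain chi' where "chi' \<in> hom G ?B" "\<And>s. s \<in> T \<Longrightarrow> chi' s = chi s"
    using extend_hom[OF assms(1,2) B assms(4) _ T(1,4)] integer_mod_group_roots[OF assms(4)] by blast
  then show ?thesis using that[of chi'] chi T(2,3) by (metis subsetD)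
qed

section \<open>Abelian groups with commuting automorphisms\<close>

lemma (in comm_group) nat_pow_mult_distrib:
  "\<lbrakk>x \<in> carrier G; y \<in> carrier G\<rbrakk> \<Longrightarrow> (x \<otimes> y) [^] (n::nat) = x [^] n \<otimes> y [^] n"
  by (simp add: pow_mult_distrib m_comm)

lemma (in comm_group) ord_mult_coprime:
  assumes x: "x \<in> carrier G" and y: "y \<in> carrier G" and cop: "coprime (ord x) (ord y)"
  shows "ord (x \<otimes> y) = ord x * ord y"
proof (rule dvd_antisym)
  show "ord (x \<otimes> y) dvd ord x * ord y" using ord_mul_divides m_comm x y by simp
  let ?n = "ord (x \<otimes> y)"
  have eq: "x [^] ?n \<otimes> y [^] ?n = \<one>"
    using nat_pow_mult_distrib[OF x y, of ?n] pow_ord_eq_1[of "x \<otimes> y"] x y by simp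
  have y1: "(y [^] ?n) [^] ord y = \<one>" and x1: "(x [^] ?n) [^] ord x = \<one>"
    using x y by (metis pow_ord_eq_1 nat_pow_pow mult.commute nat_pow_one)+
  have "(x [^] ?n \<otimes> y [^] ?n) [^] ord y = \<one>" "(x [^] ?n \<otimes> y [^] ?n) [^] ord x = \<one>"
    using eq by simp_all
  then have "(x [^] ?n) [^] ord y = \<one>" "(y [^] ?n) [^] ord x = \<one>"
    using x y x1 y1 by (simp_all add: nat_pow_mult_distrib)
  then have "ord x dvd ?n * ord y" "ord y dvd ?n * ord x"
    using x y by (simp_all add: nat_pow_pow pow_eq_id)
  then have "ord x dvd ?n" "ord y dvd ?n"
    using cop by (simp_all add: coprime_dvd_mult_left_iff coprime_commute)
  then show "ord x * ord y dvd ?n" using cop by (simp add: divides_mult)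
qed

text \<open>
If the order of \<open>y\<close> did not divide the maximal order, some prime \<open>q\<close> would occur to a higher power
in the order of \<open>y\<close> than in that of \<open>x\<close>; replacing the \<open>q\<close>-part of \<open>x\<close> by that of \<open>y\<close> would give an element of larger order.
\<close>

lemma (in comm_group) element_of_maximal_order:
  assumes fin: "finite (carrier G)"
  obtains x where "x \<in> carrier G" "\<And>y. y \<in> carrier G \<Longrightarrow> ord y dvd ord x"
proof -
  obtain x where x: "x \<in> carrier G" and max: "\<And>y. y \<in> carrier G \<Longrightarrow> ord y \<le> ord x"
    using obtains_MAX[of "carrier G" ord] fin one_closed by (metis Max_ge empty_iff finite_imageI imageI)
  have "ord y dvd ord x" if y: "y \<in> carrier G" for y
  proof (rule ccontr)
    assume "\<not> ord y dvd ord x"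
    have pos: "0 < ord x" "0 < ord y"
      using ord_ge_1[OF fin x] ord_ge_1[OF fin y] by auto
    obtain q where q: "Factorial_Ring.prime q" "\<not> multiplicity q (ord y) \<le> multiplicity q (ord x)"
      using multiplicity_le_imp_dvd[of "ord y" "ord x"] pos \<open>\<not> ord y dvd ord x\<close> by force
    define a where "a = multiplicity q (ord x)"
    define b where "b = multiplicity q (ord y)"
    obtain m where m: "ord x = q ^ a * m" "\<not> q dvd m"
      using multiplicity_decompose'[of "ord x" q] pos q unfolding a_def by (metis not_prime_unit not_gr0)
    obtain n where n: "ord y = q ^ b * n"
      using multiplicity_dvd[of q "ord y"] unfolding b_def by blast
    \<comment> \<open>the part of \<open>x\<close> prime to \<open>q\<close> and the \<open>q\<close>-part of \<open>y\<close>\<close>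
    have ox: "ord (x [^] (q ^ a)) = m"
      using ord_pow_gen[OF x, of "q ^ a"] m q by (simp add: prime_gt_0_nat)
    have oy: "ord (y [^] n) = q ^ b"
      using ord_pow_gen[OF y, of n] n pos by simp
    have "coprime m (q ^ b)"
      using prime_imp_coprime[OF q(1) m(2)] by (simp add: coprime_commute)
    then have "ord (x [^] (q ^ a) \<otimes> y [^] n) = m * q ^ b"
      using ord_mult_coprime ox oy x y by simp
    then have "m * q ^ b \<le> q ^ a * m"
      using max[of "x [^] (q ^ a) \<otimes> y [^] n"] x y m by simp
    then have "q ^ b \<le> q ^ a" using m pos by (simp add: mult.commute)
    then show False using q prime_gt_1_nat[OF q(1)] by (simp add: a_def b_def)
  qed
  then show ?thesis using x that by blast
qed

text \<open>
In additive notation this is \<open>1 + h\<close> with \<open>h a = chi a \<cdot> v\<close>. As \<open>chi v = 0\<close>, \<open>h\<close> has square zero,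
so \<open>1 + h\<close> is invertible.
\<close>

lemma shear_automorphism:
  assumes "comm_group G" "finite (carrier G)" "chi \<in> hom G (integer_mod_group e)"
    and v: "v \<in> carrier G" "v [^]\<^bsub>G\<^esub> e = \<one>\<^bsub>G\<^esub>" "chi v = 0"
  shows "(\<lambda>a. a \<otimes>\<^bsub>G\<^esub> v [^]\<^bsub>G\<^esub> chi a) \<in> iso G G"
proof -
  interpret G: comm_group G by fact
  let ?B = "integer_mod_group e"
  interpret chi: group_hom G ?B chi
    using assms by (simp add: group_hom_def group_hom_axioms_def)
  let ?h = "\<lambda>a. a \<otimes>\<^bsub>G\<^esub> v [^]\<^bsub>G\<^esub> chi a"
  have "G.ord v dvd e" using v by (simp add: G.pow_eq_id)
  \<comment> \<open>exponents of \<open>v\<close> may be reduced modulo \<open>e\<close>, so the character values can be added as integers\<close>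
  then have red: "v [^]\<^bsub>G\<^esub> (j mod int e) = v [^]\<^bsub>G\<^esub> j" for j :: int
    using v(1) by (subst G.int_pow_eq) (auto simp: mod_eq_dvd_iff dvd_diff_commute intro: dvd_trans[of _ "int e"])
  have "?h \<in> hom G G"
  proof (rule homI)
    fix a b assume ab: "a \<in> carrier G" "b \<in> carrier G"
    then have "v [^]\<^bsub>G\<^esub> chi (a \<otimes>\<^bsub>G\<^esub> b) = v [^]\<^bsub>G\<^esub> chi a \<otimes>\<^bsub>G\<^esub> v [^]\<^bsub>G\<^esub> chi b"
      using v by (simp add: red G.int_pow_mult)
    then show "?h (a \<otimes>\<^bsub>G\<^esub> b) = ?h a \<otimes>\<^bsub>G\<^esub> ?h b"
      using ab v by (simp add: G.m_ac)
  qed (use v in auto)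
  then interpret h: group_hom G G ?h
    by (simp add: group_hom_def group_hom_axioms_def)
  have "a = \<one>\<^bsub>G\<^esub>" if a: "a \<in> carrier G" "?h a = \<one>\<^bsub>G\<^esub>" for a
  proof -
    have "a = inv\<^bsub>G\<^esub> (v [^]\<^bsub>G\<^esub> chi a)"
      using a v by (metis G.inv_equality G.int_pow_closed)
    then have "a = v [^]\<^bsub>G\<^esub> (- chi a)" using v by (simp add: G.int_pow_neg)
    then have "chi a = chi v [^]\<^bsub>?B\<^esub> (- chi a)" using v by (metis chi.hom_int_pow)
    then have "chi a = 0" by (simp add: v int_pow_integer_mod_group)
    then show ?thesis using a by simp
  qed
  then have "inj_on ?h (carrier G)" using h.inj_on_one_iff by blast
  moreover from this have "?h ` carrier G = carrier G"
    by (intro endo_inj_surj[OF assms(2)] image_subsetI h.hom_closed)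
  ultimately have "bij_betw ?h (carrier G) (carrier G)" unfolding bij_betw_def by blast
  then show ?thesis using h.homh by (simp add: iso_def)
qed

text \<open>
Let \<open>x\<close> have maximal order \<open>e\<close>. If \<open>x\<close> does not generate \<open>G\<close>, a character that is 1 on \<open>x\<close> splits
off \<open>\<langle>x\<rangle>\<close>, so some \<open>y\<close> in its kernel lies outside \<open>\<langle>x\<rangle>\<close>, and there is a character \<open>eta\<close> that kills \<open>x\<close> but not \<open>y\<close>.
The two shears, adding multiples of \<open>y\<close> along \<open>x\<close> and multiples of \<open>x\<close> along \<open>y\<close>, behave like upper
and lower unitriangular matrices and do not commute.
\<close>

theorem cyclic_if_automorphisms_commute:
  assumes "comm_group G" "finite (carrier G)"
    and comm: "\<And>f g a. \<lbrakk>f \<in> iso G G; g \<in> iso G G; a \<in> carrier G\<rbrakk> \<Longrightarrow> f (g a) = g (f a)"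
  shows "cyclic_group G"
proof -
  interpret G: comm_group G by fact
  obtain x where x: "x \<in> carrier G" and max: "\<And>y. y \<in> carrier G \<Longrightarrow> G.ord y dvd G.ord x"
    using G.element_of_maximal_order[OF assms(2)] by blast
  define e where "e = G.ord x"
  have e0: "0 < e" using G.ord_ge_1[OF assms(2) x] by (simp add: e_def)
  have exp: "a [^]\<^bsub>G\<^esub> e = \<one>\<^bsub>G\<^esub>" if "a \<in> carrier G" for a
    using max that by (simp add: e_def G.pow_eq_id)
  obtain chi where chi: "chi \<in> hom G (integer_mod_group e)" "chi x = 1 mod int e"
  proof (rule separating_character[OF assms(1,2) G.triv_subgroup e0 _ x, of e])
    fix j :: int assume "x [^]\<^bsub>G\<^esub> j \<in> {\<one>\<^bsub>G\<^esub>}"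
    then show "int e dvd j" using x by (simp add: e_def G.int_pow_eq_id)
  qed (use exp x e0 in auto)
  interpret chi: group_hom G "integer_mod_group e" chi
    using chi by (simp add: group_hom_def group_hom_axioms_def)
  define C where "C = generate G {x}"
  have C: "subgroup C G"
    using G.generate_is_subgroup[of "{x}"] x by (simp add: C_def)
  have C_eq: "C = {x [^]\<^bsub>G\<^esub> (n::int) | n. n \<in> UNIV}"
    unfolding C_def by (rule G.generate_pow[OF x])
  have "z \<in> C" if z: "z \<in> carrier G" for z
  proof (rule ccontr)
    assume "z \<notin> C"
    \<comment> \<open>the component of \<open>z\<close> in the complement \<open>ker chi\<close> of \<open>\<langle>x\<rangle>\<close>\<close>
    define y where "y = z \<otimes>\<^bsub>G\<^esub> x [^]\<^bsub>G\<^esub> (- chi z)"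
    have y: "y \<in> carrier G" using x z by (simp add: y_def)
    have yC: "y \<notin> C"
    proof
      assume "y \<in> C"
      moreover have "x [^]\<^bsub>G\<^esub> (chi z) \<in> C" by (auto simp: C_eq)
      ultimately have "y \<otimes>\<^bsub>G\<^esub> x [^]\<^bsub>G\<^esub> (chi z) \<in> C" by (rule subgroup.m_closed[OF C])
      then show False using \<open>z \<notin> C\<close> x z by (simp add: y_def G.m_assoc flip: G.int_pow_mult)
    qed
    have "chi z \<in> carrier (integer_mod_group e)" using z by simp
    then have "chi y = (chi z - chi z * (1 mod int e)) mod int e"
      using x z e0 chi(2) by (simp add: y_def chi.hom_int_pow int_pow_integer_mod_group mod_mult_right_eq mod_add_right_eq)
    also have "\<dots> = 0" by (metis mod_diff_right_eq mod_mult_right_eq mult_1_right diff_self mod_0)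
    finally have chiy: "chi y = 0" .
    have expC: "a [^]\<^bsub>G\<^esub> e \<in> C" if "a \<in> carrier G" for a
      using exp[OF that] subgroup.one_closed[OF C] by simp
    obtain k where k: "0 < k" "y [^]\<^bsub>G\<^esub> (k::nat) \<in> C" "\<And>j::int. y [^]\<^bsub>G\<^esub> j \<in> C \<Longrightarrow> int k dvd j"
      using G.relative_order[OF C y e0 expC[OF y]] by blast
    obtain eta where eta: "eta \<in> hom G (integer_mod_group e)" "\<And>s. s \<in> C \<Longrightarrow> eta s = 0"
        "eta y = int (e div k) mod int e"
      using separating_character[OF assms(1,2) C e0 expC y k(2,3)] by blast
    interpret eta: group_hom G "integer_mod_group e" eta
      using eta by (simp add: group_hom_def group_hom_axioms_def)
    have "k dvd e"
      using k(3)[of "int e"] expC[OF y] by (simp add: int_pow_int)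
    have "k \<noteq> 1" using k(2) yC y by auto
    have "e div k < e" "0 < e div k"
      using \<open>k \<noteq> 1\<close> k(1) e0 dvd_imp_le[OF \<open>k dvd e\<close> e0] by (simp_all add: div_less_dividend div_greater_zero_iff)
    then have etay: "0 < eta y" "eta y < int e" by (simp_all add: eta(3))
    have "1 < e" using etay by linarith
    have xC: "x \<in> C" by (simp add: C_def generate.incl)
    let ?f = "\<lambda>a. a \<otimes>\<^bsub>G\<^esub> y [^]\<^bsub>G\<^esub> chi a"
    let ?g = "\<lambda>a. a \<otimes>\<^bsub>G\<^esub> x [^]\<^bsub>G\<^esub> eta a"
    have f: "?f \<in> iso G G" by (rule shear_automorphism[OF assms(1,2) chi(1) y exp[OF y] chiy])
    have g: "?g \<in> iso G G" by (rule shear_automorphism[OF assms(1,2) eta(1) x exp[OF x] eta(2)[OF xC]])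
    have chix: "chi x = 1" using chi(2) \<open>1 < e\<close> by simp
    have fx: "?f x = x \<otimes>\<^bsub>G\<^esub> y" using x y chix by simp
    have gx: "?g x = x" using x eta(2)[OF xC] by simp
    have eta_xy: "eta (x \<otimes>\<^bsub>G\<^esub> y) = eta y" using x y eta(2)[OF xC] etay by simp
    have "?f (?g x) = ?g (?f x)" by (rule comm[OF f g x])
    then have "x \<otimes>\<^bsub>G\<^esub> y = (x \<otimes>\<^bsub>G\<^esub> y) \<otimes>\<^bsub>G\<^esub> x [^]\<^bsub>G\<^esub> eta y" by (simp only: fx gx eta_xy)
    then have "x [^]\<^bsub>G\<^esub> eta y = \<one>\<^bsub>G\<^esub>"
      using x y by (simp add: G.l_cancel_one')
    then have "int e dvd eta y" using x by (simp add: e_def G.int_pow_eq_id)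
    then show False using etay by (simp add: zdvd_not_zless)
  qed
  moreover have "C \<subseteq> carrier G" using C by (rule subgroup.subset)
  ultimately show ?thesis using x unfolding G.cyclic_group C_eq by (auto intro!: bexI[of _ x])
qed

section \<open>Automorphism groups and isomorphisms\<close>

lemma carrier_AutoGroup: "carrier (AutoGroup G) = iso G G \<inter> extensional (carrier G)"
  by (auto simp: AutoGroup_def auto_def iso_def Bij_def)

lemma mult_AutoGroup:
  "\<lbrakk>f \<in> carrier (AutoGroup G); g \<in> carrier (AutoGroup G)\<rbrakk>
    \<Longrightarrow> f \<otimes>\<^bsub>AutoGroup G\<^esub> g = compose (carrier G) f g"
  by (simp add: AutoGroup_def auto_def BijGroup_def)

lemma mult_AutoGroup_apply:
  "\<lbrakk>f \<in> carrier (AutoGroup G); g \<in> carrier (AutoGroup G); x \<in> carrier G\<rbrakk>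
    \<Longrightarrow> (f \<otimes>\<^bsub>AutoGroup G\<^esub> g) x = f (g x)"
  by (simp add: mult_AutoGroup compose_eq)

lemma one_AutoGroup: "\<one>\<^bsub>AutoGroup G\<^esub> = (\<lambda>x\<in>carrier G. x)"
  by (simp add: AutoGroup_def BijGroup_def)

lemma AutoGroup_apply_closed:
  "\<lbrakk>f \<in> carrier (AutoGroup G); x \<in> carrier G\<rbrakk> \<Longrightarrow> f x \<in> carrier G"
  by (auto simp: carrier_AutoGroup iso_def hom_def)

lemma AutoGroup_apply_mult:
  "\<lbrakk>f \<in> carrier (AutoGroup G); x \<in> carrier G; y \<in> carrier G\<rbrakk> \<Longrightarrow> f (x \<otimes>\<^bsub>G\<^esub> y) = f x \<otimes>\<^bsub>G\<^esub> f y"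
  by (auto simp: carrier_AutoGroup iso_def hom_def)

lemma AutoGroup_eqI:
  assumes "f \<in> carrier (AutoGroup G)" "g \<in> carrier (AutoGroup G)"
    and "\<And>x. x \<in> carrier G \<Longrightarrow> f x = g x"
  shows "f = g"
  using assms by (auto simp: carrier_AutoGroup intro: extensionalityI)

lemma restrict_iso_in_AutoGroup:
  assumes "group G" "f \<in> iso G G" shows "restrict f (carrier G) \<in> carrier (AutoGroup G)"
proof -
  interpret group G by fact
  show ?thesis using assms(2) by (auto simp: carrier_AutoGroup iso_def hom_def cong: bij_betw_cong)
qed

text \<open>
Automorphisms are extensional functions, so conjugating by an isomorphism has to be followed by a
restriction to the carrier.
\<close>

lemma transport_AutoGroup:
  assumes "group G" "group H" "h \<in> iso G H" "h' \<in> iso H G"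
    and hh: "\<And>x. x \<in> carrier G \<Longrightarrow> h' (h x) = x"
  shows "(\<lambda>f. \<lambda>y\<in>carrier H. h (f (h' y))) \<in> hom (AutoGroup G) (AutoGroup H)"
proof -
  let ?F = "\<lambda>f. \<lambda>y\<in>carrier H. h (f (h' y))"
  have cl: "h x \<in> carrier H" if "x \<in> carrier G" for x
    using \<open>h \<in> iso G H\<close> that by (auto simp: iso_def hom_def)
  have cl': "h' x \<in> carrier G" if "x \<in> carrier H" for x
    using \<open>h' \<in> iso H G\<close> that by (auto simp: iso_def hom_def)
  have mem: "?F f \<in> carrier (AutoGroup H)" if "f \<in> carrier (AutoGroup G)" for f
  proof (rule restrict_iso_in_AutoGroup[OF \<open>group H\<close>])
    have "h \<circ> (f \<circ> h') \<in> iso H H"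
      using \<open>h \<in> iso G H\<close> \<open>h' \<in> iso H G\<close> that
      by (auto simp: carrier_AutoGroup intro!: iso_set_trans[of _ _ G])
    then show "(\<lambda>y. h (f (h' y))) \<in> iso H H" by (simp add: comp_def)
  qed
  have "?F \<in> hom (AutoGroup G) (AutoGroup H)"
  proof (rule homI)
    fix f g assume fg: "f \<in> carrier (AutoGroup G)" "g \<in> carrier (AutoGroup G)"
    then show "?F (f \<otimes>\<^bsub>AutoGroup G\<^esub> g) = ?F f \<otimes>\<^bsub>AutoGroup H\<^esub> ?F g"
      using mem[OF fg(1)] mem[OF fg(2)] cl cl' hh
      by (auto simp: mult_AutoGroup compose_def AutoGroup_apply_closed)
  qed (rule mem)
  then show ?thesis .
qed

lemma iso_AutoGroup:
  assumes "group G" "group H" "G \<cong> H"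
  shows "AutoGroup G \<cong> AutoGroup H"
proof -
  interpret G: group G by fact
  interpret H: group H by fact
  obtain h where h: "h \<in> iso G H" using assms(3) by (auto simp: is_iso_def)
  define h' where "h' = inv_into (carrier G) h"
  have h': "h' \<in> iso H G" unfolding h'_def by (rule G.iso_set_sym[OF h])
  have hh: "\<And>x. x \<in> carrier G \<Longrightarrow> h' (h x) = x" "\<And>y. y \<in> carrier H \<Longrightarrow> h (h' y) = y"
    using h by (auto simp: h'_def iso_def bij_betw_def f_inv_into_f)
  define F where "F f = (\<lambda>y\<in>carrier H. h (f (h' y)))" for f
  define F' where "F' f = (\<lambda>y\<in>carrier G. h' (f (h y)))" for f
  have homF: "F \<in> hom (AutoGroup G) (AutoGroup H)"
    using transport_AutoGroup[OF assms(1,2) h h' hh(1)] by (simp add: F_def[abs_def])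
  have homF': "F' \<in> hom (AutoGroup H) (AutoGroup G)"
    using transport_AutoGroup[OF assms(2,1) h' h hh(2)] by (simp add: F'_def[abs_def])
  have cl: "h x \<in> carrier H" if "x \<in> carrier G" for x
    using h that by (auto simp: iso_def hom_def)
  have cl': "h' x \<in> carrier G" if "x \<in> carrier H" for x
    using h' that by (auto simp: iso_def hom_def)
  have Fc: "F f \<in> carrier (AutoGroup H)" if "f \<in> carrier (AutoGroup G)" for f
    using homF that by (auto simp: hom_def)
  have F'c: "F' f \<in> carrier (AutoGroup G)" if "f \<in> carrier (AutoGroup H)" for f
    using homF' that by (auto simp: hom_def)
  have "bij_betw F (carrier (AutoGroup G)) (carrier (AutoGroup H))"
  proof (rule bij_betw_byWitness[where f' = F'])
    show "\<forall>f\<in>carrier (AutoGroup G). F' (F f) = f"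
      by (intro ballI AutoGroup_eqI[OF F'c[OF Fc]]) (auto simp: F_def F'_def hh cl AutoGroup_apply_closed)
    show "\<forall>f\<in>carrier (AutoGroup H). F (F' f) = f"
      by (intro ballI AutoGroup_eqI[OF Fc[OF F'c]]) (auto simp: F_def F'_def hh cl' AutoGroup_apply_closed)
  qed (use Fc F'c in auto)
  then show ?thesis using homF by (auto simp: is_iso_def iso_def)
qed

lemma stable_group_iso:
  assumes "group G" "group H" "G \<cong> H" "stable_group G"
  shows "stable_group H"
  using assms(4) iso_AutoGroup[OF assms(1-3)] group.iso_sym[OF assms(1,3)]
  unfolding stable_group_def by (meson iso_trans)

section \<open>Inner automorphisms and centers\<close>

lemma (in group) inv_cancel:
  assumes "x \<in> carrier G" "y \<in> carrier G"
  shows "inv x \<otimes> (x \<otimes> y) = y" "x \<otimes> (inv x \<otimes> y) = y"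
  using assms by (simp_all flip: m_assoc)

lemma (in group) conjugation_in_AutoGroup:
  assumes "g \<in> carrier G" shows "conjugation G g \<in> carrier (AutoGroup G)"
proof -
  have "(\<lambda>x. g \<otimes> x \<otimes> inv g) \<in> hom G G"
    using assms by (intro homI) (simp_all add: m_assoc inv_solve_left)
  moreover have "bij_betw (\<lambda>x. g \<otimes> x \<otimes> inv g) (carrier G) (carrier G)"
    by (rule bij_betw_byWitness[where f' = "\<lambda>x. inv g \<otimes> x \<otimes> g"])
      (use assms in \<open>auto simp: inv_cancel m_assoc\<close>)
  ultimately show ?thesis
    unfolding conjugation_def by (intro restrict_iso_in_AutoGroup is_group) (simp add: iso_def)
qed

lemma (in group) conjugation_apply:
  "x \<in> carrier G \<Longrightarrow> conjugation G g x = g \<otimes> x \<otimes> inv g"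
  by (simp add: conjugation_def)

lemma (in group) conjugation_hom: "conjugation G \<in> hom G (AutoGroup G)"
proof (rule homI)
  interpret L: group "AutoGroup G" by (rule AutoGroup)
  fix g h assume gh: "g \<in> carrier G" "h \<in> carrier G"
  show "conjugation G (g \<otimes> h) = conjugation G g \<otimes>\<^bsub>AutoGroup G\<^esub> conjugation G h"
    by (rule AutoGroup_eqI[of _ G])
      (use gh in \<open>simp_all add: conjugation_in_AutoGroup mult_AutoGroup_apply conjugation_apply m_assoc inv_mult_group\<close>)
qed (rule conjugation_in_AutoGroup)

lemma centerI:
  "\<lbrakk>z \<in> carrier G; \<And>x. x \<in> carrier G \<Longrightarrow> z \<otimes>\<^bsub>G\<^esub> x = x \<otimes>\<^bsub>G\<^esub> z\<rbrakk> \<Longrightarrow> z \<in> center G"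
  by (simp add: center_def)

lemma center_carrier: "z \<in> center G \<Longrightarrow> z \<in> carrier G"
  by (simp add: center_def)

lemma center_commutes: "\<lbrakk>z \<in> center G; x \<in> carrier G\<rbrakk> \<Longrightarrow> z \<otimes>\<^bsub>G\<^esub> x = x \<otimes>\<^bsub>G\<^esub> z"
  by (simp add: center_def)

lemma (in group) center_subgroup: "subgroup (center G) G"
proof (rule subgroupI)
  fix a assume a: "a \<in> center G"
  have "inv a \<otimes> x = x \<otimes> inv a" if "x \<in> carrier G" for x
  proof -
    have "a \<in> carrier G" "x \<otimes> a = a \<otimes> x" using center_carrier[OF a] center_commutes[OF a that] by simp_all
    then have "inv a \<otimes> (x \<otimes> a) \<otimes> inv a = inv a \<otimes> (a \<otimes> x) \<otimes> inv a" by simp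
    then show ?thesis using \<open>a \<in> carrier G\<close> that by (simp add: m_assoc inv_cancel)
  qed
  then show "inv a \<in> center G" using center_carrier[OF a] by (blast intro: centerI)
next
  fix a b assume ab: "a \<in> center G" "b \<in> center G"
  have "a \<otimes> b \<otimes> x = x \<otimes> (a \<otimes> b)" if x: "x \<in> carrier G" for x
  proof -
    have c: "a \<in> carrier G" "b \<in> carrier G" "a \<otimes> x = x \<otimes> a" "b \<otimes> x = x \<otimes> b"
      using ab[THEN center_carrier] ab[THEN center_commutes, OF x] by blast+
    have "a \<otimes> b \<otimes> x = a \<otimes> x \<otimes> b" using c(1,2) x by (simp add: m_assoc c(4))
    then show ?thesis using c(1,2) x by (simp add: c(3) m_assoc)
  qed
  then show "a \<otimes> b \<in> center G"
    using ab[THEN center_carrier] by (blast intro: centerI)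
qed (auto simp: center_def)

lemma (in group) conjugation_eq_one_iff:
  assumes "g \<in> carrier G"
  shows "conjugation G g = \<one>\<^bsub>AutoGroup G\<^esub> \<longleftrightarrow> g \<in> center G"
proof -
  have "conjugation G g = \<one>\<^bsub>AutoGroup G\<^esub> \<longleftrightarrow> (\<forall>x\<in>carrier G. g \<otimes> x \<otimes> inv g = x)"
    by (auto simp: one_AutoGroup conjugation_def fun_eq_iff restrict_def)
  also have "\<dots> \<longleftrightarrow> g \<in> center G"
    using assms by (auto simp: center_def inv_solve_right')
  finally show ?thesis .
qed

text \<open>
Hence the inner automorphisms form a normal subgroup, and an automorphism commutes with all of them
exactly when it moves every element by a central factor.
\<close>

lemma (in group) automorphism_conjugation:
  assumes f: "f \<in> carrier (AutoGroup G)" and g: "g \<in> carrier G"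
  shows "f \<otimes>\<^bsub>AutoGroup G\<^esub> conjugation G g = conjugation G (f g) \<otimes>\<^bsub>AutoGroup G\<^esub> f"
proof -
  have fg: "f g \<in> carrier G" using f g by (rule AutoGroup_apply_closed)
  interpret f: group_hom G G f
    using f by (auto simp: group_hom_def group_hom_axioms_def carrier_AutoGroup iso_def)
  interpret L: group "AutoGroup G" by (rule AutoGroup)
  show ?thesis
    by (rule AutoGroup_eqI[of _ G])
      (use f g fg in \<open>simp_all add: conjugation_in_AutoGroup mult_AutoGroup_apply conjugation_apply AutoGroup_apply_closed\<close>)
qed

lemma epi_image_center:
  assumes "h \<in> epi G H" "z \<in> center G" shows "h z \<in> center H"
proof -
  have hom: "h \<in> hom G H" and surj: "carrier H = h ` carrier G"
    using assms by (auto simp: epi_def)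
  show ?thesis
    using assms(2) hom_in_carrier[OF hom] unfolding center_def surj
    by (auto simp: hom_mult[OF hom, symmetric])
qed

lemma iso_imp_epi: "h \<in> iso G H \<Longrightarrow> h \<in> epi G H"
  by (simp add: iso_def epi_def bij_betw_def)

lemma iso_image_center:
  assumes "group G" "h \<in> iso G H"
  shows "h ` center G = center H"
proof
  have "z \<in> h ` center G" if z: "z \<in> center H" for z
  proof -
    have "z \<in> carrier H" using z by (rule center_carrier)
    then have "z = h (inv_into (carrier G) h z)"
      using assms(2) by (simp add: iso_def bij_betw_def f_inv_into_f)
    moreover have "inv_into (carrier G) h z \<in> center G"
      by (rule epi_image_center[OF iso_imp_epi[OF group.iso_set_sym[OF assms]] z])
    ultimately show ?thesis by blast
  qed
  then show "center H \<subseteq> h ` center G" by blast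
  show "h ` center G \<subseteq> center H"
    using epi_image_center[OF iso_imp_epi[OF assms(2)]] by blast
qed

section \<open>Automorphisms of a stable central extension\<close>

lemma (in group_hom) hom_eq_iff:
  assumes "x \<in> carrier G" "y \<in> carrier G"
  shows "h x = h y \<longleftrightarrow> h (x \<otimes> inv y) = \<one>\<^bsub>H\<^esub>"
  using assms by (simp add: H.inv_solve_right')

text \<open>
The setting of a finite stable group over its centerless central quotient. The isomorphism
\<open>theta\<close> onto the automorphism group is a parameter because it transports the center of \<open>G\<close> to the
center of the automorphism group.
\<close>

locale stable_central_cover = G: group G + K: group K
  for G :: "('g, 'm) monoid_scheme" and K :: "('k, 'n) monoid_scheme" +
  fixes p :: "'g \<Rightarrow> 'k" and theta :: "'g \<Rightarrow> 'g \<Rightarrow> 'g"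
  assumes finite_G: "finite (carrier G)"
    and epi: "p \<in> epi G K"
    and kernel_eq: "kernel G K p = center G"
    and centerless_K: "centerless K"
    and theta_iso: "theta \<in> iso G (AutoGroup G)"
begin

abbreviation L where "L \<equiv> AutoGroup G"

sublocale L: group L by (rule G.AutoGroup)

sublocale P: group_hom G K p
  using epi by unfold_locales (simp add: epi_def)

sublocale C: group_hom G L "conjugation G"
  using G.conjugation_hom by unfold_locales

sublocale Theta: group_hom G L theta
  using theta_iso by unfold_locales (simp add: iso_def)

lemma p_surj: "p ` carrier G = carrier K"
  using epi by (simp add: epi_def)

lemma in_center_iff: "z \<in> center G \<longleftrightarrow> z \<in> carrier G \<and> p z = \<one>\<^bsub>K\<^esub>"
  using kernel_eq by (auto simp: kernel_def)

lemma center_L: "center L = theta ` center G"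
  using iso_image_center[OF G.is_group theta_iso] by simp

lemma conjugation_eq_iff:
  assumes "g \<in> carrier G" "h \<in> carrier G"
  shows "conjugation G g = conjugation G h \<longleftrightarrow> p g = p h"
proof -
  have "g \<otimes>\<^bsub>G\<^esub> inv\<^bsub>G\<^esub> h \<in> carrier G" using assms by simp
  then show ?thesis
    unfolding C.hom_eq_iff[OF assms] P.hom_eq_iff[OF assms]
    by (simp only: G.conjugation_eq_one_iff in_center_iff simp_thms)
qed

text \<open>
The group of inner automorphisms is a copy of \<open>K\<close>, hence centerless.
\<close>

lemma inner_commuting_with_inner:
  assumes g: "g \<in> carrier G"
    and comm: "\<And>h. h \<in> carrier G \<Longrightarrow> conjugation G g \<otimes>\<^bsub>L\<^esub> conjugation G h = conjugation G h \<otimes>\<^bsub>L\<^esub> conjugation G g"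
  shows "p g = \<one>\<^bsub>K\<^esub>" "conjugation G g = \<one>\<^bsub>L\<^esub>"
proof -
  have "p g \<otimes>\<^bsub>K\<^esub> p h = p h \<otimes>\<^bsub>K\<^esub> p g" if h: "h \<in> carrier G" for h
  proof -
    have "conjugation G (g \<otimes>\<^bsub>G\<^esub> h) = conjugation G (h \<otimes>\<^bsub>G\<^esub> g)"
      using comm[OF h] g h by simp
    then have "p (g \<otimes>\<^bsub>G\<^esub> h) = p (h \<otimes>\<^bsub>G\<^esub> g)"
      using g h by (subst (asm) conjugation_eq_iff) simp_all
    then show ?thesis using g h by simp
  qed
  then have "p g \<in> center K"
    using g p_surj by (auto simp: center_def) (metis imageE)
  then show "p g = \<one>\<^bsub>K\<^esub>" using centerless_K by (simp add: centerless_def)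
  then show "conjugation G g = \<one>\<^bsub>L\<^esub>" using conjugation_eq_iff[OF g G.one_closed] by simp
qed

lemma card_product: "card (center G) * card (carrier K) = card (carrier G)"
proof -
  have "card (carrier (G Mod kernel G K p)) = card (carrier K)"
    by (rule iso_same_card[OF P.FactGroup_iso[OF p_surj]])
  moreover have "card (rcosets\<^bsub>G\<^esub> center G) * card (center G) = order G"
    by (rule G.lagrange[OF G.center_subgroup])
  ultimately show ?thesis
    by (simp add: kernel_eq FactGroup_def order_def mult.commute)
qed

text \<open>
The center of \<open>L\<close> and the inner automorphisms commute and intersect trivially, since the latter
form a centerless group. Stability makes the center of \<open>L\<close> as large as that of \<open>G\<close>, so the two
subgroups together have \<open>\<bar>Z(G)\<bar> \<cdot> \<bar>K\<bar> = \<bar>G\<bar> = \<bar>L\<bar>\<close> elements and exhaust \<open>L\<close>. As \<open>L\<close> is isomorphic to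
\<open>G\<close>, this already shows that \<open>G\<close> is a direct product.
\<close>

lemma automorphism_decomposition:
  obtains kappa where "kappa \<in> hom K L" "\<And>g. g \<in> carrier G \<Longrightarrow> kappa (p g) = conjugation G g"
    "(\<lambda>(z, k). theta z \<otimes>\<^bsub>L\<^esub> kappa k) \<in> iso (G\<lparr>carrier := center G\<rparr> \<times>\<times> K) L"
proof -
  have ker: "conjugation G x = \<one>\<^bsub>L\<^esub>" if "x \<in> carrier G" "p x = \<one>\<^bsub>K\<^esub>" for x
    using that by (simp only: G.conjugation_eq_one_iff in_center_iff simp_thms)
  obtain kappa where kappa: "kappa \<in> hom K L" "\<And>g. g \<in> carrier G \<Longrightarrow> kappa (p g) = conjugation G g"
    using hom_through_epi[OF G.is_group K.is_group L.is_group epi C.homh ker] by blast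
  interpret kappa: group_hom K L kappa using kappa(1) by unfold_locales
  let ?Z = "G\<lparr>carrier := center G\<rparr>"
  interpret D: group "?Z \<times>\<times> K"
    using G.subgroup_imp_group[OF G.center_subgroup] K.is_group by (rule DirProd_group)
  let ?f = "\<lambda>(z, k). theta z \<otimes>\<^bsub>L\<^esub> kappa k"
  have zc: "z \<in> carrier G" if "z \<in> center G" for z using that by (rule center_carrier)
  have central: "theta z \<otimes>\<^bsub>L\<^esub> l = l \<otimes>\<^bsub>L\<^esub> theta z" if "z \<in> center G" "l \<in> carrier L" for z l
    by (rule center_commutes[OF _ that(2)]) (use center_L that(1) in simp)
  have "?f \<in> hom (?Z \<times>\<times> K) L"
  proof (rule homI)
    fix u v assume "u \<in> carrier (?Z \<times>\<times> K)" "v \<in> carrier (?Z \<times>\<times> K)"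
    then obtain z k z' k' where uv: "u = (z, k)" "v = (z', k')" "z \<in> center G" "z' \<in> center G"
      "k \<in> carrier K" "k' \<in> carrier K" by auto
    have "theta z \<otimes>\<^bsub>L\<^esub> theta z' \<otimes>\<^bsub>L\<^esub> (kappa k \<otimes>\<^bsub>L\<^esub> kappa k') = theta z \<otimes>\<^bsub>L\<^esub> (theta z' \<otimes>\<^bsub>L\<^esub> kappa k) \<otimes>\<^bsub>L\<^esub> kappa k'"
      using uv zc by (simp add: L.m_assoc)
    also have "\<dots> = theta z \<otimes>\<^bsub>L\<^esub> kappa k \<otimes>\<^bsub>L\<^esub> (theta z' \<otimes>\<^bsub>L\<^esub> kappa k')"
      using uv zc by (simp add: central[of z' "kappa k"] L.m_assoc)
    finally show "?f (u \<otimes>\<^bsub>?Z \<times>\<times> K\<^esub> v) = ?f u \<otimes>\<^bsub>L\<^esub> ?f v"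
      using uv zc by simp
  qed (use zc in auto)
  then interpret f: group_hom "?Z \<times>\<times> K" L ?f by unfold_locales
  have inj: "inj_on ?f (carrier (?Z \<times>\<times> K))"
  proof -
    have "u = \<one>\<^bsub>?Z \<times>\<times> K\<^esub>" if u: "u \<in> carrier (?Z \<times>\<times> K)" "?f u = \<one>\<^bsub>L\<^esub>" for u
    proof -
      obtain z k where zk: "u = (z, k)" "z \<in> center G" "k \<in> carrier K" using u by auto
      then obtain g where g: "g \<in> carrier G" "k = p g" using p_surj by blast
      have eq: "theta z \<otimes>\<^bsub>L\<^esub> conjugation G g = \<one>\<^bsub>L\<^esub>" using u zk g kappa(2) by simp
      then have "theta z = inv\<^bsub>L\<^esub> conjugation G g"
        using g zk zc by (metis C.hom_closed L.inv_equality Theta.hom_closed L.inv_inv)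
      then have "conjugation G g = theta (inv\<^bsub>G\<^esub> z)" using g zk zc by simp
      moreover have "inv\<^bsub>G\<^esub> z \<in> center G" using zk G.center_subgroup by (simp add: subgroup.m_inv_closed)
      ultimately have "conjugation G g \<otimes>\<^bsub>L\<^esub> conjugation G h = conjugation G h \<otimes>\<^bsub>L\<^esub> conjugation G g"
        if "h \<in> carrier G" for h
        using central that by simp
      from inner_commuting_with_inner[OF g(1) this] have "k = \<one>\<^bsub>K\<^esub>" "conjugation G g = \<one>\<^bsub>L\<^esub>"
        using g by simp_all
      moreover from this have "theta z = theta \<one>\<^bsub>G\<^esub>" using eq zk zc by simp
      then have "z = \<one>\<^bsub>G\<^esub>" using theta_iso zk zc by (auto simp: iso_def bij_betw_def inj_on_def)
      ultimately show ?thesis using zk by simp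
    qed
    then show ?thesis using f.inj_on_one_iff by blast
  qed
  have bij: "bij_betw theta (carrier G) (carrier L)" using theta_iso by (simp add: iso_def)
  have "card (?f ` carrier (?Z \<times>\<times> K)) = card (carrier (?Z \<times>\<times> K))" by (rule card_image[OF inj])
  also have "\<dots> = card (carrier L)"
    using card_product bij_betw_same_card[OF bij] by (simp add: card_cartesian_product)
  finally have card: "card (?f ` carrier (?Z \<times>\<times> K)) = card (carrier L)" .
  have "finite (carrier L)" using bij_betw_finite[OF bij] finite_G by simp
  moreover have "?f ` carrier (?Z \<times>\<times> K) \<subseteq> carrier L" by (rule image_subsetI) (rule f.hom_closed)
  ultimately have "?f ` carrier (?Z \<times>\<times> K) = carrier L" using card by (rule card_subset_eq)
  then have "?f \<in> iso (?Z \<times>\<times> K) L" using f.homh inj by (simp add: iso_def bij_betw_def)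
  then show ?thesis using that kappa by blast
qed

lemma automorphism_eq_central_times_inner:
  assumes "f \<in> carrier L"
  obtains z g where "z \<in> center G" "g \<in> carrier G" "f = theta z \<otimes>\<^bsub>L\<^esub> conjugation G g"
proof -
  obtain kappa where kappa: "kappa \<in> hom K L" "\<And>g. g \<in> carrier G \<Longrightarrow> kappa (p g) = conjugation G g"
    "(\<lambda>(z, k). theta z \<otimes>\<^bsub>L\<^esub> kappa k) \<in> iso (G\<lparr>carrier := center G\<rparr> \<times>\<times> K) L"
    using automorphism_decomposition by blast
  from kappa(3) have "carrier L = (\<lambda>(z, k). theta z \<otimes>\<^bsub>L\<^esub> kappa k) ` (center G \<times> carrier K)"
    by (auto simp: iso_def bij_betw_def)
  then obtain z k where zk: "z \<in> center G" "k \<in> carrier K" "f = theta z \<otimes>\<^bsub>L\<^esub> kappa k"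
    using assms by auto
  then obtain g where "g \<in> carrier G" "k = p g" using p_surj by blast
  then show ?thesis using that zk kappa(2) by metis
qed

text \<open>
The automorphisms acting trivially on \<open>K\<close> are those that centralize the inner automorphisms. In
the product decomposition of \<open>L\<close> this centralizer is the center, again because the inner
factor is centerless.
\<close>

lemma center_L_iff:
  assumes f: "f \<in> carrier L"
  shows "f \<in> center L \<longleftrightarrow> (\<forall>x\<in>carrier G. p (f x) = p x)"
proof
  assume fc: "f \<in> center L"
  show "\<forall>x\<in>carrier G. p (f x) = p x"
  proof
    fix x assume x: "x \<in> carrier G"
    then have fx: "f x \<in> carrier G" by (rule AutoGroup_apply_closed[OF f])
    have "conjugation G x \<otimes>\<^bsub>L\<^esub> f = conjugation G (f x) \<otimes>\<^bsub>L\<^esub> f"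
      by (rule trans[OF center_commutes[OF fc G.conjugation_in_AutoGroup[OF x], symmetric] G.automorphism_conjugation[OF f x]])
    then have "conjugation G (f x) = conjugation G x" using f x fx by simp
    then show "p (f x) = p x" using conjugation_eq_iff[OF fx x] by simp
  qed
next
  assume triv: "\<forall>x\<in>carrier G. p (f x) = p x"
  have comm: "f \<otimes>\<^bsub>L\<^esub> conjugation G h = conjugation G h \<otimes>\<^bsub>L\<^esub> f" if h: "h \<in> carrier G" for h
  proof -
    have "conjugation G (f h) = conjugation G h"
      using conjugation_eq_iff[OF AutoGroup_apply_closed[OF f h] h] triv h by simp
    then show ?thesis using G.automorphism_conjugation[OF f h] by simp
  qed
  obtain z g where zg: "z \<in> center G" "g \<in> carrier G" "f = theta z \<otimes>\<^bsub>L\<^esub> conjugation G g"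
    using automorphism_eq_central_times_inner[OF f] .
  have tz: "theta z \<in> center L" using zg center_L by blast
  then have tzL: "theta z \<in> carrier L" by (rule center_carrier)
  have "conjugation G g \<otimes>\<^bsub>L\<^esub> conjugation G h = conjugation G h \<otimes>\<^bsub>L\<^esub> conjugation G g"
    if h: "h \<in> carrier G" for h
  proof -
    have "theta z \<otimes>\<^bsub>L\<^esub> (conjugation G g \<otimes>\<^bsub>L\<^esub> conjugation G h) = conjugation G h \<otimes>\<^bsub>L\<^esub> (theta z \<otimes>\<^bsub>L\<^esub> conjugation G g)"
      using comm[OF h] zg h tzL by (simp add: L.m_assoc)
    also have "\<dots> = theta z \<otimes>\<^bsub>L\<^esub> (conjugation G h \<otimes>\<^bsub>L\<^esub> conjugation G g)"
      using center_commutes[OF tz, of "conjugation G h"] zg h tzL by (simp flip: L.m_assoc)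
    finally show ?thesis using zg h tzL by simp
  qed
  from inner_commuting_with_inner(2)[OF zg(2) this] have "f = theta z" using zg tzL by simp
  then show "f \<in> center L" using tz by simp
qed

end

section \<open>Stable products with a centerless factor\<close>

lemma (in group) cyclic_group_involution_unique:
  assumes "cyclic_group G"
    and a: "a \<in> carrier G" "a \<otimes> a = \<one>" "a \<noteq> \<one>"
    and b: "b \<in> carrier G" "b \<otimes> b = \<one>" "b \<noteq> \<one>"
  shows "a = b"
proof -
  obtain x where x: "x \<in> carrier G" and gen: "carrier G = range (\<lambda>n::int. x [^] n)"
    using assms(1) unfolding cyclic_group by blast
  let ?n = "int (ord x)"
  obtain i where i: "a = x [^] (i::int)" using a gen by auto
  obtain j where j: "b = x [^] (j::int)" using b gen by auto
  have "?n dvd i + i" "\<not> ?n dvd i" "?n dvd j + j" "\<not> ?n dvd j"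
    using a b x unfolding i j by (simp_all add: int_pow_eq_id flip: int_pow_mult)
  then obtain u v where u: "i + i = ?n * u" and v: "j + j = ?n * v" by (auto elim!: dvdE)
  have "odd u" "odd v"
    using u v \<open>\<not> ?n dvd i\<close> \<open>\<not> ?n dvd j\<close> by (auto elim!: evenE)
  then obtain w where "u - v = 2 * w" by (metis even_diff odd_even_add dvdE even_add odd_add)
  then have "2 * (i - j) = 2 * (?n * w)"
    using u v by (simp add: algebra_simps)
  then have "i - j = ?n * w" by simp
  then have "?n dvd i - j" by simp
  then have "?n dvd j - i" by (simp add: dvd_diff_commute)
  then show ?thesis using x unfolding i j by (simp add: int_pow_eq)
qed

lemma (in comm_monoid) mult_swap:
  assumes "a \<in> carrier G" "b \<in> carrier G" "c \<in> carrier G" "d \<in> carrier G"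
  shows "a \<otimes> b \<otimes> (c \<otimes> d) = a \<otimes> c \<otimes> (b \<otimes> d)"
  using assms by (simp add: m_ac)

text \<open>
Block-triangular automorphisms. As \<open>A\<close> is abelian, the off-diagonal entry \<open>f\<close> can be any
homomorphism.
\<close>

lemma product_automorphism:
  assumes "comm_group A" "group K" "alpha \<in> iso A A" "beta \<in> iso K K" "f \<in> hom K A"
  shows "(\<lambda>(a, k). (alpha a \<otimes>\<^bsub>A\<^esub> f k, beta k)) \<in> iso (A \<times>\<times> K) (A \<times>\<times> K)"
proof -
  interpret A: comm_group A by fact
  interpret K: group K by fact
  interpret al: group_hom A A alpha using assms(3) by unfold_locales (simp add: iso_def)
  interpret be: group_hom K K beta using assms(4) by unfold_locales (simp add: iso_def)
  interpret f: group_hom K A f using assms(5) by unfold_locales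
  let ?h = "\<lambda>(a, k). (alpha a \<otimes>\<^bsub>A\<^esub> f k, beta k)"
  have hom: "?h \<in> hom (A \<times>\<times> K) (A \<times>\<times> K)"
  proof (rule homI)
    fix u v assume "u \<in> carrier (A \<times>\<times> K)" "v \<in> carrier (A \<times>\<times> K)"
    then obtain a k b l where uv: "u = (a, k)" "v = (b, l)" "a \<in> carrier A" "b \<in> carrier A"
      "k \<in> carrier K" "l \<in> carrier K" by auto
    have "alpha a \<otimes>\<^bsub>A\<^esub> alpha b \<otimes>\<^bsub>A\<^esub> (f k \<otimes>\<^bsub>A\<^esub> f l) = alpha a \<otimes>\<^bsub>A\<^esub> f k \<otimes>\<^bsub>A\<^esub> (alpha b \<otimes>\<^bsub>A\<^esub> f l)"
      using al.hom_closed[OF uv(3)] al.hom_closed[OF uv(4)] f.hom_closed[OF uv(5)] f.hom_closed[OF uv(6)]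
      by (rule A.mult_swap)
    with uv show "?h (u \<otimes>\<^bsub>A \<times>\<times> K\<^esub> v) = ?h u \<otimes>\<^bsub>A \<times>\<times> K\<^esub> ?h v"
      by (simp only: mult_DirProd split_conv al.hom_mult be.hom_mult f.hom_mult)
  qed auto
  have al: "inj_on alpha (carrier A)" "alpha ` carrier A = carrier A"
    and be: "inj_on beta (carrier K)" "beta ` carrier K = carrier K"
    using assms(3,4) by (simp_all add: iso_def bij_betw_def)
  have "inj_on ?h (carrier (A \<times>\<times> K))"
  proof (rule inj_onI)
    fix u v assume "u \<in> carrier (A \<times>\<times> K)" "v \<in> carrier (A \<times>\<times> K)" and eq: "?h u = ?h v"
    then obtain a k b l where uv: "u = (a, k)" "v = (b, l)" "a \<in> carrier A" "b \<in> carrier A"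
      "k \<in> carrier K" "l \<in> carrier K" by auto
    have "k = l" using inj_onD[OF be(1) _ uv(5,6)] eq by (simp add: uv(1,2))
    then have "alpha a \<otimes>\<^bsub>A\<^esub> f k = alpha b \<otimes>\<^bsub>A\<^esub> f k" using eq by (simp add: uv(1,2))
    then have "alpha a = alpha b"
      by (rule A.right_cancel[OF f.hom_closed[OF uv(5)] al.hom_closed[OF uv(3)] al.hom_closed[OF uv(4)], THEN iffD1])
    then have "a = b" using inj_onD[OF al(1) _ uv(3,4)] by simp
    with \<open>k = l\<close> show "u = v" by (simp add: uv(1,2))
  qed
  moreover have "?h ` carrier (A \<times>\<times> K) = carrier (A \<times>\<times> K)"
  proof
    show "?h ` carrier (A \<times>\<times> K) \<subseteq> carrier (A \<times>\<times> K)"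
      using hom unfolding hom_def by blast
    show "carrier (A \<times>\<times> K) \<subseteq> ?h ` carrier (A \<times>\<times> K)"
    proof
      fix y assume "y \<in> carrier (A \<times>\<times> K)"
      then obtain b l where y: "y = (b, l)" "b \<in> carrier A" "l \<in> carrier K" by auto
      obtain k where k: "k \<in> carrier K" "l = beta k" using be(2) y(3) by blast
      then have "b \<otimes>\<^bsub>A\<^esub> inv\<^bsub>A\<^esub> f k \<in> carrier A" using y by simp
      then obtain a where a: "a \<in> carrier A" "b \<otimes>\<^bsub>A\<^esub> inv\<^bsub>A\<^esub> f k = alpha a" using al(2) by blast
      then have "alpha a \<otimes>\<^bsub>A\<^esub> f k = b" using y k by (simp add: A.m_assoc flip: a(2))
      then show "y \<in> ?h ` carrier (A \<times>\<times> K)" using y k a by (intro image_eqI[of _ _ "(a, k)"]) auto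
    qed
  qed
  ultimately show ?thesis using hom by (simp add: iso_def bij_betw_def)
qed

lemma id_iso: "(\<lambda>x. x) \<in> iso G G"
  by (simp add: iso_def hom_def bij_betw_def)

lemma trivial_hom: "group T \<Longrightarrow> (\<lambda>_. \<one>\<^bsub>T\<^esub>) \<in> hom K T"
  by (intro homI) (simp_all add: group.is_monoid)

lemma (in comm_group) inverse_iso: "(\<lambda>a. inv a) \<in> iso G G"
proof -
  have "bij_betw (\<lambda>a. inv a) (carrier G) (carrier G)"
    by (rule bij_betw_byWitness[where f' = "\<lambda>a. inv a"]) auto
  then show ?thesis by (auto simp: iso_def hom_def inv_mult)
qed

lemma center_DirProd_centerless:
  assumes "comm_group A" "group K" "centerless K"
  shows "center (A \<times>\<times> K) = carrier A \<times> {\<one>\<^bsub>K\<^esub>}"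
proof -
  interpret A: comm_group A by fact
  interpret K: group K by fact
  have "center (A \<times>\<times> K) = carrier A \<times> center K"
    by (auto simp: center_def A.m_comm)
  then show ?thesis using assms(3) by (simp add: centerless_def)
qed

definition nontrivial_hom :: "('a, 'm) monoid_scheme \<Rightarrow> ('b, 'n) monoid_scheme \<Rightarrow> ('a \<Rightarrow> 'b) \<Rightarrow> bool"
  where "nontrivial_hom K T f \<longleftrightarrow> f \<in> hom K T \<and> (\<exists>k\<in>carrier K. f k \<noteq> \<one>\<^bsub>T\<^esub>)"

text \<open>
Homomorphisms are unrestricted outside the carrier, so uniqueness can only be demanded on it.
\<close>

definition unique_nontrivial_hom :: "('a, 'm) monoid_scheme \<Rightarrow> ('b, 'n) monoid_scheme \<Rightarrow> bool"
  where "unique_nontrivial_hom K T \<longleftrightarrow> (\<exists>f. nontrivial_hom K T f) \<and>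
    (\<forall>f g k. nontrivial_hom K T f \<and> nontrivial_hom K T g \<and> k \<in> carrier K \<longrightarrow> f k = g k)"

text \<open>
The case to which the splitting reduces the forward direction.
\<close>

locale stable_product = A: comm_group A + K: group K
  for A :: "('a, 'm) monoid_scheme" and K :: "('k, 'n) monoid_scheme" +
  fixes theta :: "'a \<times> 'k \<Rightarrow> 'a \<times> 'k \<Rightarrow> 'a \<times> 'k"
  assumes finite_A: "finite (carrier A)"
    and nontrivial_A: "carrier A \<noteq> {\<one>\<^bsub>A\<^esub>}"
    and finite_K: "finite (carrier K)"
    and centerless: "centerless K"
    and theta: "theta \<in> iso (A \<times>\<times> K) (AutoGroup (A \<times>\<times> K))"
begin

sublocale S: stable_central_cover "A \<times>\<times> K" K snd theta
proof (intro stable_central_cover.intro stable_central_cover_axioms.intro)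
  show "group (A \<times>\<times> K)" using A.is_group K.is_group by (rule DirProd_group)
  show "group K" by (rule K.is_group)
  show "finite (carrier (A \<times>\<times> K))" using finite_A finite_K by simp
  show "snd \<in> epi (A \<times>\<times> K) K"
    using A.one_closed by (auto simp: epi_def hom_def image_iff)
  show "kernel (A \<times>\<times> K) K snd = center (A \<times>\<times> K)"
    unfolding center_DirProd_centerless[OF A.comm_group_axioms K.is_group centerless]
    by (auto simp: kernel_def)
qed (rule centerless theta)+

definition autom :: "('a \<Rightarrow> 'a) \<Rightarrow> ('k \<Rightarrow> 'k) \<Rightarrow> ('k \<Rightarrow> 'a) \<Rightarrow> 'a \<times> 'k \<Rightarrow> 'a \<times> 'k"
  where "autom alpha beta f = (\<lambda>(a, k)\<in>carrier (A \<times>\<times> K). (alpha a \<otimes>\<^bsub>A\<^esub> f k, beta k))"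

lemma autom_closed:
  assumes "alpha \<in> iso A A" "beta \<in> iso K K" "f \<in> hom K A"
  shows "autom alpha beta f \<in> carrier S.L"
  unfolding autom_def
  by (rule restrict_iso_in_AutoGroup[OF S.G.is_group product_automorphism[OF A.comm_group_axioms K.is_group assms]])

lemma autom_apply:
  "\<lbrakk>a \<in> carrier A; k \<in> carrier K\<rbrakk> \<Longrightarrow> autom alpha beta f (a, k) = (alpha a \<otimes>\<^bsub>A\<^esub> f k, beta k)"
  by (simp add: autom_def)

lemma autom_central:
  assumes "alpha \<in> iso A A" "f \<in> hom K A"
  shows "autom alpha (\<lambda>k. k) f \<in> center S.L"
  unfolding S.center_L_iff[OF autom_closed[OF assms(1) id_iso assms(2)]]
  by (auto simp: autom_apply)

lemma center_commute_apply:
  assumes "f \<in> center S.L" "g \<in> center S.L" "x \<in> carrier (A \<times>\<times> K)"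
  shows "f (g x) = g (f x)"
  using center_commutes[OF assms(1) center_carrier[OF assms(2)]]
    mult_AutoGroup_apply[OF center_carrier[OF assms(1)] center_carrier[OF assms(2)] assms(3)]
    mult_AutoGroup_apply[OF center_carrier[OF assms(2)] center_carrier[OF assms(1)] assms(3)]
  by metis

text \<open>
The automorphisms of \<open>A\<close>, acting on the first factor only, lie in the center of \<open>L\<close> and hence
commute.
\<close>

lemma cyclic_A: "cyclic_group A"
proof (rule cyclic_if_automorphisms_commute[OF A.comm_group_axioms finite_A])
  fix f g a assume fg: "f \<in> iso A A" "g \<in> iso A A" and a: "a \<in> carrier A"
  have cl: "f a \<in> carrier A" "g a \<in> carrier A" "f (g a) \<in> carrier A" "g (f a) \<in> carrier A"
    using fg a by (auto simp: iso_def hom_def)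
  note c = autom_central[OF _ trivial_hom[OF A.is_group]]
  show "f (g a) = g (f a)"
    using center_commute_apply[OF c[OF fg(1)] c[OF fg(2)], of "(a, \<one>\<^bsub>K\<^esub>)"] a cl
    by (simp add: autom_apply)
qed

text \<open>
Every automorphism of \<open>K\<close> extends to the product. The extension is a central automorphism times an
inner one, and the central one is invisible on \<open>K\<close>.
\<close>

lemma complete_K: "complete_group K"
proof -
  interpret AK: group "AutoGroup K" by (rule K.AutoGroup)
  interpret C: group_hom K "AutoGroup K" "conjugation K"
    using K.conjugation_hom by unfold_locales
  have "inj_on (conjugation K) (carrier K)"
    unfolding C.inj_on_one_iff
    using centerless by (simp add: K.conjugation_eq_one_iff centerless_def)
  moreover have "beta \<in> conjugation K ` carrier K" if beta: "beta \<in> carrier (AutoGroup K)" for beta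
  proof -
    have bi: "beta \<in> iso K K" using beta by (simp add: carrier_AutoGroup)
    define b where "b = autom (\<lambda>a. a) beta (\<lambda>_. \<one>\<^bsub>A\<^esub>)"
    have "b \<in> carrier S.L"
      unfolding b_def by (rule autom_closed[OF id_iso bi trivial_hom[OF A.is_group]])
    then obtain z g where zg: "z \<in> center (A \<times>\<times> K)" "g \<in> carrier (A \<times>\<times> K)"
        "b = theta z \<otimes>\<^bsub>S.L\<^esub> conjugation (A \<times>\<times> K) g"
      by (rule S.automorphism_eq_central_times_inner)
    have tz: "theta z \<in> center S.L" using zg(1) S.center_L by blast
    note tz' = center_carrier[OF tz]
    have sg: "snd g \<in> carrier K" using zg(2) by auto
    have "beta k = conjugation K (snd g) k" if k: "k \<in> carrier K" for k
    proof -
      let ?y = "(\<one>\<^bsub>A\<^esub>, k)"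
      have y: "?y \<in> carrier (A \<times>\<times> K)" using k by simp
      have cy: "conjugation (A \<times>\<times> K) g ?y \<in> carrier (A \<times>\<times> K)"
        by (rule AutoGroup_apply_closed[OF S.G.conjugation_in_AutoGroup[OF zg(2)] y])
      have "beta k = snd (b ?y)" using k by (simp add: b_def autom_apply)
      also have "b ?y = theta z (conjugation (A \<times>\<times> K) g ?y)"
        unfolding zg(3) by (rule mult_AutoGroup_apply[OF tz' S.G.conjugation_in_AutoGroup[OF zg(2)] y])
      also have "snd \<dots> = snd (conjugation (A \<times>\<times> K) g ?y)"
        using S.center_L_iff[OF tz'] tz cy by blast
      also have "\<dots> = snd g \<otimes>\<^bsub>K\<^esub> k \<otimes>\<^bsub>K\<^esub> inv\<^bsub>K\<^esub> snd g"
        using zg(2) k y S.P.hom_inv[OF zg(2)] by (simp add: S.G.conjugation_apply[OF y] mult_DirProd')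
      finally show ?thesis using k by (simp add: K.conjugation_apply)
    qed
    then have "beta = conjugation K (snd g)"
      by (rule AutoGroup_eqI[OF beta K.conjugation_in_AutoGroup[OF sg]])
    then show ?thesis using sg by blast
  qed
  ultimately have "bij_betw (conjugation K) (carrier K) (carrier (AutoGroup K))"
    using K.conjugation_in_AutoGroup by (auto simp: bij_betw_def)
  then show ?thesis by (simp add: complete_group_def iso_def K.conjugation_hom)
qed

end

context stable_product
begin

text \<open>
The center of \<open>L\<close> is isomorphic to the cyclic group \<open>A\<close>.
\<close>

lemma central_involution_unique:
  assumes b: "b \<in> center S.L" "b \<otimes>\<^bsub>S.L\<^esub> b = \<one>\<^bsub>S.L\<^esub>" "b \<noteq> \<one>\<^bsub>S.L\<^esub>"
    and c: "c \<in> center S.L" "c \<otimes>\<^bsub>S.L\<^esub> c = \<one>\<^bsub>S.L\<^esub>" "c \<noteq> \<one>\<^bsub>S.L\<^esub>"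
  shows "b = c"
proof -
  have "\<exists>a\<in>carrier A. a \<otimes>\<^bsub>A\<^esub> a = \<one>\<^bsub>A\<^esub> \<and> a \<noteq> \<one>\<^bsub>A\<^esub> \<and> d = theta (a, \<one>\<^bsub>K\<^esub>)"
    if d: "d \<in> center S.L" "d \<otimes>\<^bsub>S.L\<^esub> d = \<one>\<^bsub>S.L\<^esub>" "d \<noteq> \<one>\<^bsub>S.L\<^esub>" for d
  proof -
    obtain a where a: "a \<in> carrier A" "d = theta (a, \<one>\<^bsub>K\<^esub>)"
      using d(1) unfolding S.center_L
        center_DirProd_centerless[OF A.comm_group_axioms K.is_group centerless] by blast
    have ac: "(a, \<one>\<^bsub>K\<^esub>) \<in> carrier (A \<times>\<times> K)" using a by simp
    have "theta ((a, \<one>\<^bsub>K\<^esub>) \<otimes>\<^bsub>A \<times>\<times> K\<^esub> (a, \<one>\<^bsub>K\<^esub>)) = theta \<one>\<^bsub>A \<times>\<times> K\<^esub>"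
      unfolding S.Theta.hom_mult[OF ac ac] S.Theta.hom_one using d(2) a(2) by simp
    then have "(a, \<one>\<^bsub>K\<^esub>) \<otimes>\<^bsub>A \<times>\<times> K\<^esub> (a, \<one>\<^bsub>K\<^esub>) = \<one>\<^bsub>A \<times>\<times> K\<^esub>"
      using theta S.G.m_closed[OF ac ac] S.G.one_closed unfolding iso_def bij_betw_def by (blast dest: inj_onD)
    then have "a \<otimes>\<^bsub>A\<^esub> a = \<one>\<^bsub>A\<^esub>" by simp
    moreover have "a \<noteq> \<one>\<^bsub>A\<^esub>" using d(3) a(2) S.Theta.hom_one by auto
    ultimately show ?thesis using a by blast
  qed
  from this[OF b] this[OF c] show ?thesis
    using A.cyclic_group_involution_unique[OF cyclic_A] by metis
qed

text \<open>
Without a nontrivial homomorphism from \<open>K\<close> to \<open>A\<close>, an element of the center of \<open>L\<close> would be an automorphism of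
the cyclic group \<open>A\<close>, determined by the image of a generator, and that image is not the identity.
This leaves at most \<open>\<bar>A\<bar> - 1\<close> elements, but the center of \<open>L\<close> has \<open>\<bar>A\<bar>\<close>.
\<close>

lemma nontrivial_hom_exists: "\<exists>f. nontrivial_hom K A f"
proof (rule ccontr)
  assume "\<nexists>f. nontrivial_hom K A f"
  then have triv: "f k = \<one>\<^bsub>A\<^esub>" if "f \<in> hom K A" "k \<in> carrier K" for f k
    using that by (auto simp: nontrivial_hom_def)
  obtain x where x: "x \<in> carrier A" and gen: "carrier A = range (\<lambda>n::int. x [^]\<^bsub>A\<^esub> n)"
    using cyclic_A unfolding A.cyclic_group by blast
  have x1: "x \<noteq> \<one>\<^bsub>A\<^esub>"
  proof
    assume "x = \<one>\<^bsub>A\<^esub>"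
    then have "carrier A = {\<one>\<^bsub>A\<^esub>}" using gen by auto
    then show False using nontrivial_A by simp
  qed
  let ?x = "(x, \<one>\<^bsub>K\<^esub>)"
  have xc: "?x \<in> carrier (A \<times>\<times> K)" using x by simp
  define ev where "ev b = fst (b ?x)" for b :: "'a \<times> 'k \<Rightarrow> 'a \<times> 'k"
  have snd_eq: "snd (b y) = snd y" if "b \<in> center S.L" "y \<in> carrier (A \<times>\<times> K)" for b y
    using S.center_L_iff[OF center_carrier[OF that(1)]] that by blast
  \<comment> \<open>\<open>fst (b (1, k))\<close> is a homomorphism in \<open>k\<close>, hence trivial, so \<open>b\<close> fixes the second factor\<close>
  have split: "b y = b (fst y, \<one>\<^bsub>K\<^esub>) \<otimes>\<^bsub>A \<times>\<times> K\<^esub> (\<one>\<^bsub>A\<^esub>, snd y)"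
    if b: "b \<in> center S.L" and y: "y \<in> carrier (A \<times>\<times> K)" for b y
  proof -
    obtain a k where ak: "y = (a, k)" "a \<in> carrier A" "k \<in> carrier K" using y by auto
    note bc = center_carrier[OF b]
    have "(\<lambda>k. fst (b (\<one>\<^bsub>A\<^esub>, k))) \<in> hom K A"
    proof (rule homI)
      fix k assume k: "k \<in> carrier K"
      then show "fst (b (\<one>\<^bsub>A\<^esub>, k)) \<in> carrier A"
        using AutoGroup_apply_closed[OF bc, of "(\<one>\<^bsub>A\<^esub>, k)"] by auto
      fix l assume l: "l \<in> carrier K"
      show "fst (b (\<one>\<^bsub>A\<^esub>, k \<otimes>\<^bsub>K\<^esub> l)) = fst (b (\<one>\<^bsub>A\<^esub>, k)) \<otimes>\<^bsub>A\<^esub> fst (b (\<one>\<^bsub>A\<^esub>, l))"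
        using AutoGroup_apply_mult[OF bc, of "(\<one>\<^bsub>A\<^esub>, k)" "(\<one>\<^bsub>A\<^esub>, l)"] k l
        by (simp add: mult_DirProd')
    qed
    then have "fst (b (\<one>\<^bsub>A\<^esub>, k)) = \<one>\<^bsub>A\<^esub>" using triv ak(3) by blast
    moreover have "snd (b (\<one>\<^bsub>A\<^esub>, k)) = k" using snd_eq[OF b, of "(\<one>\<^bsub>A\<^esub>, k)"] ak by simp
    ultimately have "b (\<one>\<^bsub>A\<^esub>, k) = (\<one>\<^bsub>A\<^esub>, k)" by (simp add: prod_eq_iff)
    then show ?thesis
      using AutoGroup_apply_mult[OF bc, of "(a, \<one>\<^bsub>K\<^esub>)" "(\<one>\<^bsub>A\<^esub>, k)"] ak by simp
  qed
  have "inj_on ev (center S.L)"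
  proof (rule inj_onI)
    fix b c assume bc: "b \<in> center S.L" "c \<in> center S.L" and eq: "ev b = ev c"
    interpret b: group_hom "A \<times>\<times> K" "A \<times>\<times> K" b
      using center_carrier[OF bc(1)] by unfold_locales (simp add: carrier_AutoGroup iso_def)
    interpret c: group_hom "A \<times>\<times> K" "A \<times>\<times> K" c
      using center_carrier[OF bc(2)] by unfold_locales (simp add: carrier_AutoGroup iso_def)
    have bx: "b ?x = c ?x"
      using eq snd_eq[OF bc(1) xc] snd_eq[OF bc(2) xc] by (simp add: ev_def prod_eq_iff)
    interpret emb: group_hom A "A \<times>\<times> K" "\<lambda>a. (a, \<one>\<^bsub>K\<^esub>)"
      by unfold_locales (simp add: hom_def)
    have on_A: "b (a, \<one>\<^bsub>K\<^esub>) = c (a, \<one>\<^bsub>K\<^esub>)" if a: "a \<in> carrier A" for a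
    proof -
      obtain n :: int where "a = x [^]\<^bsub>A\<^esub> n" using a unfolding gen by blast
      then have "(a, \<one>\<^bsub>K\<^esub>) = ?x [^]\<^bsub>A \<times>\<times> K\<^esub> n" using emb.hom_int_pow[OF x] by simp
      then show ?thesis using b.hom_int_pow[OF xc] c.hom_int_pow[OF xc] bx by simp
    qed
    show "b = c"
    proof (rule AutoGroup_eqI[OF center_carrier[OF bc(1)] center_carrier[OF bc(2)]])
      fix y assume y: "y \<in> carrier (A \<times>\<times> K)"
      then have "fst y \<in> carrier A" by auto
      then show "b y = c y" unfolding split[OF bc(1) y] split[OF bc(2) y] by (simp only: on_A)
    qed
  qed
  moreover have "ev ` center S.L \<subseteq> carrier A - {\<one>\<^bsub>A\<^esub>}"
  proof
    fix a assume "a \<in> ev ` center S.L"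
    then obtain b where b: "b \<in> center S.L" "a = ev b" by blast
    note bc = center_carrier[OF b(1)]
    have bxc: "b ?x \<in> carrier (A \<times>\<times> K)" by (rule AutoGroup_apply_closed[OF bc xc])
    have "a \<noteq> \<one>\<^bsub>A\<^esub>"
    proof
      assume "a = \<one>\<^bsub>A\<^esub>"
      then have "b ?x = \<one>\<^bsub>A \<times>\<times> K\<^esub>"
        using b snd_eq[OF b(1) xc] by (simp add: ev_def prod_eq_iff)
      moreover interpret b: group_hom "A \<times>\<times> K" "A \<times>\<times> K" b
        using bc by unfold_locales (simp add: carrier_AutoGroup iso_def)
      have "b \<one>\<^bsub>A \<times>\<times> K\<^esub> = \<one>\<^bsub>A \<times>\<times> K\<^esub>" by (rule b.hom_one)
      moreover have "inj_on b (carrier (A \<times>\<times> K))" using bc by (simp add: carrier_AutoGroup iso_def bij_betw_def)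
      ultimately have "?x = \<one>\<^bsub>A \<times>\<times> K\<^esub>" using xc S.G.one_closed by (metis inj_onD)
      then show False using x1 by simp
    qed
    moreover have "a \<in> carrier A" using bxc b(2) by (auto simp: ev_def)
    ultimately show "a \<in> carrier A - {\<one>\<^bsub>A\<^esub>}" by simp
  qed
  ultimately have "card (center S.L) \<le> card (carrier A - {\<one>\<^bsub>A\<^esub>})"
    using finite_A by (metis card_inj_on_le finite_Diff)
  also have "\<dots> < card (carrier A)" using finite_A by (intro psubset_card_mono) auto
  also have "card (carrier A) = card (center (A \<times>\<times> K))"
    unfolding center_DirProd_centerless[OF A.comm_group_axioms K.is_group centerless]
    by (simp add: card_cartesian_product)
  also have "\<dots> = card (center S.L)"
  proof -
    have "inj_on theta (center (A \<times>\<times> K))"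
      using theta subgroup.subset[OF S.G.center_subgroup] unfolding iso_def bij_betw_def
      by (blast intro: inj_on_subset)
    then show ?thesis by (simp add: S.center_L card_image)
  qed
  finally show False by simp
qed

definition shift :: "('k \<Rightarrow> 'a) \<Rightarrow> 'a \<times> 'k \<Rightarrow> 'a \<times> 'k"
  where "shift f = autom (\<lambda>a. a) (\<lambda>k. k) f"

lemma shift_central: "f \<in> hom K A \<Longrightarrow> shift f \<in> center S.L"
  unfolding shift_def by (rule autom_central[OF id_iso])

lemma shift_apply: "\<lbrakk>a \<in> carrier A; k \<in> carrier K\<rbrakk> \<Longrightarrow> shift f (a, k) = (a \<otimes>\<^bsub>A\<^esub> f k, k)"
  by (simp add: shift_def autom_apply)

definition inversion :: "'a \<times> 'k \<Rightarrow> 'a \<times> 'k"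
  where "inversion = autom (\<lambda>a. inv\<^bsub>A\<^esub> a) (\<lambda>k. k) (\<lambda>_. \<one>\<^bsub>A\<^esub>)"

lemma inversion_central: "inversion \<in> center S.L"
  unfolding inversion_def by (rule autom_central[OF A.inverse_iso trivial_hom[OF A.is_group]])

lemma inversion_apply: "\<lbrakk>a \<in> carrier A; k \<in> carrier K\<rbrakk> \<Longrightarrow> inversion (a, k) = (inv\<^bsub>A\<^esub> a, k)"
  by (simp add: inversion_def autom_apply)

lemma AutoGroup_involutionI:
  assumes "b \<in> center S.L" "\<And>a k. \<lbrakk>a \<in> carrier A; k \<in> carrier K\<rbrakk> \<Longrightarrow> b (b (a, k)) = (a, k)"
  shows "b \<otimes>\<^bsub>S.L\<^esub> b = \<one>\<^bsub>S.L\<^esub>"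
proof -
  note bc = center_carrier[OF assms(1)]
  show ?thesis
    by (rule AutoGroup_eqI[OF S.L.m_closed[OF bc bc] S.L.one_closed])
      (use assms(2) in \<open>auto simp: mult_AutoGroup_apply[OF bc bc] one_AutoGroup\<close>)
qed

text \<open>
A shift commutes with the inversion of \<open>A\<close>, as both are central; evaluating this at
\<open>(1, k)\<close> gives \<open>f k = (f k)\<^sup>-\<^sup>1\<close>. So every shift by a nontrivial homomorphism is an involution.
\<close>

lemma nontrivial_shift:
  assumes "nontrivial_hom K A f"
  shows "shift f \<in> center S.L" "shift f \<otimes>\<^bsub>S.L\<^esub> shift f = \<one>\<^bsub>S.L\<^esub>" "shift f \<noteq> \<one>\<^bsub>S.L\<^esub>"
    "shift f \<noteq> inversion"
proof -
  have f: "f \<in> hom K A" using assms by (simp add: nontrivial_hom_def)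
  obtain k0 where k0: "k0 \<in> carrier K" "f k0 \<noteq> \<one>\<^bsub>A\<^esub>" using assms by (auto simp: nontrivial_hom_def)
  have fc: "f k \<in> carrier A" if "k \<in> carrier K" for k using f that by (rule hom_in_carrier)
  show c: "shift f \<in> center S.L" by (rule shift_central[OF f])
  have sq: "f k \<otimes>\<^bsub>A\<^esub> f k = \<one>\<^bsub>A\<^esub>" if k: "k \<in> carrier K" for k
  proof -
    have "f k = inv\<^bsub>A\<^esub> (f k)"
      using center_commute_apply[OF c inversion_central, of "(\<one>\<^bsub>A\<^esub>, k)"] k fc[OF k]
      by (simp add: shift_apply inversion_apply)
    then show ?thesis using fc[OF k] by (metis A.r_inv)
  qed
  show "shift f \<otimes>\<^bsub>S.L\<^esub> shift f = \<one>\<^bsub>S.L\<^esub>"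
    by (rule AutoGroup_involutionI[OF c]) (simp add: shift_apply fc sq A.m_assoc)
  have s: "shift f (\<one>\<^bsub>A\<^esub>, k0) = (f k0, k0)" using k0 fc by (simp add: shift_apply)
  show "shift f \<noteq> \<one>\<^bsub>S.L\<^esub>"
  proof
    assume "shift f = \<one>\<^bsub>S.L\<^esub>"
    then show False using s k0 by (simp add: one_AutoGroup)
  qed
  show "shift f \<noteq> inversion"
  proof
    assume "shift f = inversion"
    then show False using s k0 by (simp add: inversion_apply)
  qed
qed

text \<open>
Two such homomorphisms give central involutions, and there is only one.
\<close>

lemma unique_nontrivial_hom_K_A: "unique_nontrivial_hom K A"
  unfolding unique_nontrivial_hom_def
proof (intro conjI allI impI)
  show "\<exists>f. nontrivial_hom K A f" by (rule nontrivial_hom_exists)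
  fix f g k assume fgk: "nontrivial_hom K A f \<and> nontrivial_hom K A g \<and> k \<in> carrier K"
  then have f: "nontrivial_hom K A f" and g: "nontrivial_hom K A g" by simp_all
  have "shift f = shift g"
    by (rule central_involution_unique[OF nontrivial_shift(1-3)[OF f] nontrivial_shift(1-3)[OF g]])
  then have "shift f (\<one>\<^bsub>A\<^esub>, k) = shift g (\<one>\<^bsub>A\<^esub>, k)" by simp
  moreover have "f k \<in> carrier A" "g k \<in> carrier A"
    using fgk by (auto simp: nontrivial_hom_def intro: hom_in_carrier)
  ultimately show "f k = g k" using fgk by (simp add: shift_apply)
qed

text \<open>
The inversion would be a central involution different from a nontrivial shift, unless it is the
identity.
\<close>

lemma exponent_two: "a \<in> carrier A \<Longrightarrow> a \<otimes>\<^bsub>A\<^esub> a = \<one>\<^bsub>A\<^esub>"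
proof -
  assume a: "a \<in> carrier A"
  obtain f where f: "nontrivial_hom K A f" using nontrivial_hom_exists by blast
  have "inversion \<otimes>\<^bsub>S.L\<^esub> inversion = \<one>\<^bsub>S.L\<^esub>"
    by (rule AutoGroup_involutionI[OF inversion_central]) (simp add: inversion_apply)
  then have "inversion = \<one>\<^bsub>S.L\<^esub>"
    using nontrivial_shift[OF f] central_involution_unique inversion_central by metis
  then have "inv\<^bsub>A\<^esub> a = a" using inversion_apply[OF a K.one_closed] a by (simp add: one_AutoGroup)
  then show ?thesis using a by (metis A.r_inv)
qed

lemma A_iso_Z2: "A \<cong> integer_mod_group 2"
proof -
  obtain u where u: "u \<in> carrier A" "u \<noteq> \<one>\<^bsub>A\<^esub>" using nontrivial_A A.one_closed by blast
  then have carr: "carrier A = {\<one>\<^bsub>A\<^esub>, u}"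
    using A.cyclic_group_involution_unique[OF cyclic_A] exponent_two by blast
  let ?h = "\<lambda>a. if a = \<one>\<^bsub>A\<^esub> then 0 else 1 :: int"
  have "?h \<in> hom A (integer_mod_group 2)"
    using u(2) exponent_two[OF u(1)] u(1) by (auto simp: hom_def carr carrier_integer_mod_group)
  moreover have "bij_betw ?h (carrier A) (carrier (integer_mod_group 2))"
    unfolding bij_betw_def using u(2) by (auto simp: inj_on_def carr carrier_integer_mod_group image_iff)
  ultimately show ?thesis by (auto simp: is_iso_def iso_def)
qed

end

section \<open>Stability of the product with a group of order two\<close>

lemma carrier_Z2: "carrier (integer_mod_group 2) = {0, 1}"
  by (auto simp: carrier_integer_mod_group)

lemma hom_Z2_cases:
  assumes "f \<in> hom K (integer_mod_group 2)" "x \<in> carrier K"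
  shows "f x = 0 \<or> f x = 1"
  using hom_in_carrier[OF assms] by (simp add: carrier_Z2)

text \<open>
An automorphism of the product fixes the center \<open>Z\<close> pointwise, because \<open>Z\<close> has order two. It
therefore consists of an automorphism of \<open>K\<close>, which is inner, and a homomorphism from \<open>K\<close> to \<open>Z\<close>,
which is \<open>c \<cdot> f\<close> for some \<open>c\<close> in \<open>Z\<close>. So the pairs \<open>(c, k)\<close> parametrize the
automorphisms. The parametrization is a homomorphism because inner automorphisms do not change the
values of \<open>f\<close>.
\<close>

theorem stable_Z2_product:
  assumes "group K" "centerless K" "complete_group K"
    and unique: "unique_nontrivial_hom K (integer_mod_group 2)"
  shows "stable_group (integer_mod_group 2 \<times>\<times> K)"
proof -
  interpret K: group K by fact
  define Z where "Z = integer_mod_group 2"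
  have Zcomm: "comm_group Z" by (simp add: Z_def)
  interpret Z: comm_group Z by (rule Zcomm)
  interpret P: group "Z \<times>\<times> K" using Z.is_group K.is_group by (rule DirProd_group)
  interpret L: group "AutoGroup (Z \<times>\<times> K)" by (rule P.AutoGroup)
  have Zcar: "carrier Z = {0, 1}" by (simp add: Z_def carrier_Z2)
  have Zmult: "a \<otimes>\<^bsub>Z\<^esub> b = (a + b) mod 2" for a b by (simp add: Z_def)
  have Zone: "\<one>\<^bsub>Z\<^esub> = 0" by (simp add: Z_def)
  obtain f x0 where f: "f \<in> hom K Z" and x0: "x0 \<in> carrier K" "f x0 \<noteq> 0"
    using unique by (auto simp: unique_nontrivial_hom_def nontrivial_hom_def Z_def)
  interpret f: group_hom K Z f using f by unfold_locales
  have fx0: "f x0 = 1" using x0 f.hom_closed[OF x0(1)] by (simp add: Zcar)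
  have f01: "f x = 0 \<or> f x = 1" if "x \<in> carrier K" for x
    using f.hom_closed[OF that] by (simp add: Zcar)
  have fm: "f (x \<otimes>\<^bsub>K\<^esub> y) = (f x + f y) mod 2" if "x \<in> carrier K" "y \<in> carrier K" for x y
    using that by (simp add: Zmult)
  have fconj: "f (conjugation K k x) = f x" if "k \<in> carrier K" "x \<in> carrier K" for k x
  proof -
    have "f (k \<otimes>\<^bsub>K\<^esub> x \<otimes>\<^bsub>K\<^esub> inv\<^bsub>K\<^esub> k) = f k \<otimes>\<^bsub>Z\<^esub> f x \<otimes>\<^bsub>Z\<^esub> inv\<^bsub>Z\<^esub> f k"
      using that by simp
    also have "\<dots> = f x \<otimes>\<^bsub>Z\<^esub> (f k \<otimes>\<^bsub>Z\<^esub> inv\<^bsub>Z\<^esub> f k)"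
      using f.hom_closed[OF that(1)] f.hom_closed[OF that(2)] Z.m_comm[of "f k" "f x"]
      by (simp only: Z.m_assoc Z.inv_closed)
    also have "\<dots> = f x"
      using f.hom_closed[OF that(1)] f.hom_closed[OF that(2)] by (simp only: Z.r_inv Z.r_one)
    finally show ?thesis using that by (simp add: K.conjugation_apply)
  qed
  have conj_bij: "bij_betw (conjugation K) (carrier K) (carrier (AutoGroup K))"
    using assms(3) by (simp add: complete_group_def iso_def)
  \<comment> \<open>the multiple \<open>c \<cdot> f\<close> for \<open>c\<close> in \<open>{0, 1}\<close>\<close>
  define cf where "cf c x = (c * f x) mod 2" for c :: int and x
  have cf_hom: "cf c \<in> hom K Z" for c
  proof (rule homI)
    fix x y assume xy: "x \<in> carrier K" "y \<in> carrier K"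
    have "(c * ((f x + f y) mod 2)) mod 2 = (c * f x + c * f y) mod 2"
      by (simp only: mod_mult_right_eq distrib_left)
    then show "cf c (x \<otimes>\<^bsub>K\<^esub> y) = cf c x \<otimes>\<^bsub>Z\<^esub> cf c y"
      using xy by (simp only: cf_def fm Zmult mod_add_eq)
  qed (auto simp: cf_def Zcar)
  define Psi where "Psi = (\<lambda>(c, k). \<lambda>(a, x)\<in>carrier (Z \<times>\<times> K). (a \<otimes>\<^bsub>Z\<^esub> cf c x, conjugation K k x))"
  have Psi_apply: "Psi (c, k) (a, x) = ((a + c * f x) mod 2, conjugation K k x)"
    if "a \<in> carrier Z" "x \<in> carrier K" for c k a x
    using that by (simp add: Psi_def cf_def Zmult mod_add_right_eq)
  have Psi_closed: "Psi (c, k) \<in> carrier (AutoGroup (Z \<times>\<times> K))" if "k \<in> carrier K" for c k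
  proof -
    have "conjugation K k \<in> iso K K"
      using K.conjugation_in_AutoGroup[OF that] by (simp add: carrier_AutoGroup)
    from restrict_iso_in_AutoGroup[OF P.is_group product_automorphism[OF Zcomm K.is_group id_iso this cf_hom]]
    show ?thesis by (simp add: Psi_def)
  qed
  have conj_closed: "conjugation K k x \<in> carrier K" if "k \<in> carrier K" "x \<in> carrier K" for k x
    using AutoGroup_apply_closed[OF K.conjugation_in_AutoGroup[OF that(1)] that(2)] .
  have mod2: "(a + b) mod 2 \<in> carrier Z" for a b by (auto simp: Zcar)
  have "Psi \<in> hom (Z \<times>\<times> K) (AutoGroup (Z \<times>\<times> K))"
  proof (rule homI)
    fix u assume "u \<in> carrier (Z \<times>\<times> K)"
    then show "Psi u \<in> carrier (AutoGroup (Z \<times>\<times> K))" using Psi_closed by auto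
  next
    fix u v assume "u \<in> carrier (Z \<times>\<times> K)" "v \<in> carrier (Z \<times>\<times> K)"
    then obtain c k d l where uv: "u = (c, k)" "v = (d, l)" "k \<in> carrier K" "l \<in> carrier K" by auto
    have kl: "k \<otimes>\<^bsub>K\<^esub> l \<in> carrier K" using uv by simp
    have m: "u \<otimes>\<^bsub>Z \<times>\<times> K\<^esub> v = ((c + d) mod 2, k \<otimes>\<^bsub>K\<^esub> l)" by (simp add: uv(1,2) Zmult)
    show "Psi (u \<otimes>\<^bsub>Z \<times>\<times> K\<^esub> v) = Psi u \<otimes>\<^bsub>AutoGroup (Z \<times>\<times> K)\<^esub> Psi v"
      unfolding m unfolding uv(1,2)
    proof (rule AutoGroup_eqI[OF Psi_closed[OF kl] L.m_closed[OF Psi_closed[OF uv(3)] Psi_closed[OF uv(4)]]])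
      fix y assume y: "y \<in> carrier (Z \<times>\<times> K)"
      then obtain a x where ax: "y = (a, x)" "a \<in> carrier Z" "x \<in> carrier K" by auto
      have "(Psi (c, k) \<otimes>\<^bsub>AutoGroup (Z \<times>\<times> K)\<^esub> Psi (d, l)) y
          = (((a + d * f x) mod 2 + c * f x) mod 2, conjugation K k (conjugation K l x))"
        unfolding mult_AutoGroup_apply[OF Psi_closed[OF uv(3)] Psi_closed[OF uv(4)] y]
        unfolding ax(1) Psi_apply[OF ax(2,3)] Psi_apply[OF mod2 conj_closed[OF uv(4) ax(3)]]
        by (simp only: fconj[OF uv(4) ax(3)])
      moreover have "conjugation K k (conjugation K l x) = conjugation K (k \<otimes>\<^bsub>K\<^esub> l) x"
        unfolding hom_mult[OF K.conjugation_hom uv(3,4)]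
        by (rule mult_AutoGroup_apply[OF K.conjugation_in_AutoGroup[OF uv(3)] K.conjugation_in_AutoGroup[OF uv(4)] ax(3), symmetric])
      moreover have "((a + d * f x) mod 2 + c * f x) mod 2 = (a + ((c + d) mod 2) * f x) mod 2"
        using f01[OF ax(3)] by (auto simp: mod_simps algebra_simps)
      ultimately show "Psi ((c + d) mod 2, k \<otimes>\<^bsub>K\<^esub> l) y = (Psi (c, k) \<otimes>\<^bsub>AutoGroup (Z \<times>\<times> K)\<^esub> Psi (d, l)) y"
        unfolding ax(1) Psi_apply[OF ax(2,3)] by simp
    qed
  qed
  moreover have "inj_on Psi (carrier (Z \<times>\<times> K))"
  proof (rule inj_onI)
    fix u v assume "u \<in> carrier (Z \<times>\<times> K)" "v \<in> carrier (Z \<times>\<times> K)" and eq: "Psi u = Psi v"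
    then obtain c k d l where uv: "u = (c, k)" "v = (d, l)" "c \<in> carrier Z" "d \<in> carrier Z"
      "k \<in> carrier K" "l \<in> carrier K" by auto
    have z: "0 \<in> carrier Z" by (simp add: Zcar)
    have e: "((0 + c * f x) mod 2, conjugation K k x) = ((0 + d * f x) mod 2, conjugation K l x)"
      if "x \<in> carrier K" for x
      using Psi_apply[OF z that] eq uv(1,2) by metis
    have "conjugation K k = conjugation K l"
      by (rule AutoGroup_eqI[OF K.conjugation_in_AutoGroup[OF uv(5)] K.conjugation_in_AutoGroup[OF uv(6)]])
        (use e in blast)
    then have "k = l" using conj_bij uv(5,6) unfolding bij_betw_def by (blast dest: inj_onD)
    moreover have "c = d" using e[OF x0(1)] uv(3,4) by (auto simp: fx0 Zcar)
    ultimately show "u = v" by (simp add: uv(1,2))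
  qed
  moreover have "phi \<in> Psi ` carrier (Z \<times>\<times> K)" if phi: "phi \<in> carrier (AutoGroup (Z \<times>\<times> K))" for phi
  proof -
    interpret phi: group_hom "Z \<times>\<times> K" "Z \<times>\<times> K" phi
      using phi by unfold_locales (simp add: carrier_AutoGroup iso_def)
    have phi_iso: "phi \<in> iso (Z \<times>\<times> K) (Z \<times>\<times> K)" using phi by (simp add: carrier_AutoGroup)
    have inj: "inj_on phi (carrier (Z \<times>\<times> K))" and surj: "phi ` carrier (Z \<times>\<times> K) = carrier (Z \<times>\<times> K)"
      using phi_iso by (simp_all add: iso_def bij_betw_def)
    have cen: "center (Z \<times>\<times> K) = carrier Z \<times> {\<one>\<^bsub>K\<^esub>}"
      by (rule center_DirProd_centerless[OF Zcomm K.is_group assms(2)])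
    \<comment> \<open>an automorphism fixes the only non-identity element of the center\<close>
    have phi_Z: "phi (a, \<one>\<^bsub>K\<^esub>) = (a, \<one>\<^bsub>K\<^esub>)" if a: "a \<in> carrier Z" for a
    proof -
      have one: "phi (0, \<one>\<^bsub>K\<^esub>) = (0, \<one>\<^bsub>K\<^esub>)" using phi.hom_one by (simp add: Zone)
      have "phi (1, \<one>\<^bsub>K\<^esub>) \<in> carrier Z \<times> {\<one>\<^bsub>K\<^esub>}"
        using epi_image_center[OF iso_imp_epi[OF phi_iso], of "(1, \<one>\<^bsub>K\<^esub>)"] unfolding cen
        by (simp add: Zcar)
      then obtain b where b: "b \<in> carrier Z" "phi (1, \<one>\<^bsub>K\<^esub>) = (b, \<one>\<^bsub>K\<^esub>)" by blast
      have "b \<noteq> 0"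
      proof
        assume "b = 0"
        then have "(1, \<one>\<^bsub>K\<^esub>) = (0 :: int, \<one>\<^bsub>K\<^esub>)"
          using inj_onD[OF inj, of "(1, \<one>\<^bsub>K\<^esub>)" "(0, \<one>\<^bsub>K\<^esub>)"] b one by (simp add: Zcar)
        then show False by simp
      qed
      then have "phi (1, \<one>\<^bsub>K\<^esub>) = (1, \<one>\<^bsub>K\<^esub>)" using b by (simp add: Zcar)
      then show ?thesis using a one by (auto simp: Zcar)
    qed
    define g where "g x = fst (phi (0, x))" for x
    define be where "be x = snd (phi (0, x))" for x
    have z: "0 \<in> carrier Z" by (simp add: Zcar)
    have gb: "phi (0, x) = (g x, be x)" "g x \<in> carrier Z" "be x \<in> carrier K" if x: "x \<in> carrier K" for x
      using phi.hom_closed[of "(0, x)"] z x by (auto simp: g_def be_def)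
    have gbm: "g (x \<otimes>\<^bsub>K\<^esub> y) = g x \<otimes>\<^bsub>Z\<^esub> g y \<and> be (x \<otimes>\<^bsub>K\<^esub> y) = be x \<otimes>\<^bsub>K\<^esub> be y"
      if xy: "x \<in> carrier K" "y \<in> carrier K" for x y
    proof -
      have "phi ((0, x) \<otimes>\<^bsub>Z \<times>\<times> K\<^esub> (0, y)) = phi (0, x) \<otimes>\<^bsub>Z \<times>\<times> K\<^esub> phi (0, y)"
        by (rule phi.hom_mult) (use z xy in auto)
      moreover have "(0, x) \<otimes>\<^bsub>Z \<times>\<times> K\<^esub> (0, y) = (0, x \<otimes>\<^bsub>K\<^esub> y)" by (simp add: Zmult)
      ultimately show ?thesis using gb(1)[OF xy(1)] gb(1)[OF xy(2)] gb(1)[of "x \<otimes>\<^bsub>K\<^esub> y"] xy by simp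
    qed
    have phi_eq: "phi (a, x) = (a \<otimes>\<^bsub>Z\<^esub> g x, be x)" if ax: "a \<in> carrier Z" "x \<in> carrier K" for a x
    proof -
      have "phi ((a, \<one>\<^bsub>K\<^esub>) \<otimes>\<^bsub>Z \<times>\<times> K\<^esub> (0, x)) = phi (a, \<one>\<^bsub>K\<^esub>) \<otimes>\<^bsub>Z \<times>\<times> K\<^esub> phi (0, x)"
        by (rule phi.hom_mult) (use z ax in auto)
      moreover have "(a, \<one>\<^bsub>K\<^esub>) \<otimes>\<^bsub>Z \<times>\<times> K\<^esub> (0, x) = (a, x)"
        using ax by (auto simp: Zmult Zcar)
      ultimately show ?thesis using phi_Z[OF ax(1)] gb[OF ax(2)] by simp
    qed
    have g_hom: "g \<in> hom K Z" using gb gbm by (intro homI) auto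
    have be_hom: "be \<in> hom K K" using gb gbm by (intro homI) auto
    interpret be: group_hom K K be using be_hom by unfold_locales
    have "x = \<one>\<^bsub>K\<^esub>" if x: "x \<in> carrier K" "be x = \<one>\<^bsub>K\<^esub>" for x
    proof -
      have eq: "phi (0, x) = phi (g x, \<one>\<^bsub>K\<^esub>)" using gb[OF x(1)] x phi_Z by simp
      have "(0, x) = (g x, \<one>\<^bsub>K\<^esub>)"
        by (rule inj_onD[OF inj eq]) (use gb(2)[OF x(1)] x(1) z in auto)
      then show ?thesis by simp
    qed
    then have "inj_on be (carrier K)" using be.inj_on_one_iff by blast
    moreover have "be ` carrier K = carrier K"
    proof
      show "be ` carrier K \<subseteq> carrier K" using gb(3) by blast
      show "carrier K \<subseteq> be ` carrier K"
      proof
        fix k assume "k \<in> carrier K"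
        then have "(0, k) \<in> phi ` carrier (Z \<times>\<times> K)" unfolding surj using z by simp
        then obtain a x where "a \<in> carrier Z" "x \<in> carrier K" "(0, k) = phi (a, x)" by auto
        then show "k \<in> be ` carrier K" using phi_eq by auto
      qed
    qed
    ultimately have "be \<in> iso K K" using be_hom by (simp add: iso_def bij_betw_def)
    then have "restrict be (carrier K) \<in> conjugation K ` carrier K"
      using restrict_iso_in_AutoGroup[OF K.is_group] conj_bij by (simp add: bij_betw_def)
    then obtain k where k: "k \<in> carrier K" "restrict be (carrier K) = conjugation K k" by blast
    have be_eq: "be x = conjugation K k x" if "x \<in> carrier K" for x
      using fun_cong[OF k(2), of x] that by simp
    have "\<exists>c\<in>carrier Z. \<forall>x\<in>carrier K. g x = (c * f x) mod 2"
    proof (cases "\<exists>x\<in>carrier K. g x \<noteq> 0")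
      case True
      then have "\<forall>x\<in>carrier K. g x = f x"
        using unique g_hom f x0 unfolding unique_nontrivial_hom_def nontrivial_hom_def
        unfolding Z_def by (metis one_integer_mod_group)
      moreover have "f x mod 2 = f x" if "x \<in> carrier K" for x using f01[OF that] by auto
      ultimately show ?thesis by (intro bexI[of _ 1]) (auto simp: Zcar)
    next
      case False
      then show ?thesis by (intro bexI[of _ 0]) (auto simp: Zcar)
    qed
    then obtain c where c: "c \<in> carrier Z" "\<And>x. x \<in> carrier K \<Longrightarrow> g x = (c * f x) mod 2" by blast
    have "phi = Psi (c, k)"
    proof (rule AutoGroup_eqI[OF phi Psi_closed[OF k(1)]])
      fix y assume "y \<in> carrier (Z \<times>\<times> K)"
      then obtain a x where ax: "y = (a, x)" "a \<in> carrier Z" "x \<in> carrier K" by auto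
      show "phi y = Psi (c, k) y"
        unfolding ax(1) phi_eq[OF ax(2,3)] Psi_apply[OF ax(2,3)]
        by (simp add: Zmult be_eq[OF ax(3)] c(2)[OF ax(3)] mod_add_right_eq)
    qed
    then show ?thesis using c(1) k(1) by (intro image_eqI[of _ _ "(c, k)"]) auto
  qed
  ultimately have "Psi \<in> iso (Z \<times>\<times> K) (AutoGroup (Z \<times>\<times> K))"
    by (auto simp: iso_def bij_betw_def hom_def)
  then show ?thesis unfolding stable_group_def Z_def is_iso_def by blast
qed

section \<open>Homomorphisms onto a group of order two and Sylow subgroups\<close>

lemma nontrivial_hom_comp_epi:
  assumes "p \<in> epi K Q" "nontrivial_hom Q T f"
  shows "nontrivial_hom K T (f \<circ> p)"
proof -
  have p: "p \<in> hom K Q" "p ` carrier K = carrier Q" using assms(1) by (auto simp: epi_def)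
  have f: "f \<in> hom Q T" using assms(2) by (simp add: nontrivial_hom_def)
  obtain q where q: "q \<in> carrier Q" "f q \<noteq> \<one>\<^bsub>T\<^esub>" using assms(2) by (auto simp: nontrivial_hom_def)
  then obtain k where "k \<in> carrier K" "q = p k" using p(2) by blast
  moreover have "f \<circ> p \<in> hom K T"
    using hom_in_carrier[OF p(1)] hom_in_carrier[OF f] hom_mult[OF p(1)] hom_mult[OF f] by (intro homI) auto
  ultimately show ?thesis using q(2) unfolding nontrivial_hom_def comp_def by blast
qed

lemma unique_nontrivial_hom_epi:
  assumes "group K" "group Q" "group T" and p: "p \<in> epi K Q"
    and ker: "\<And>f x. \<lbrakk>f \<in> hom K T; x \<in> carrier K; p x = \<one>\<^bsub>Q\<^esub>\<rbrakk> \<Longrightarrow> f x = \<one>\<^bsub>T\<^esub>"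
  shows "unique_nontrivial_hom K T \<longleftrightarrow> unique_nontrivial_hom Q T"
proof -
  have pc: "p k \<in> carrier Q" if "k \<in> carrier K" for k
    using p that by (auto simp: epi_def hom_def)
  have surj: "\<exists>k\<in>carrier K. q = p k" if "q \<in> carrier Q" for q
    using p that by (auto simp: epi_def)
  have factor: "\<exists>f'. nontrivial_hom Q T f' \<and> (\<forall>k\<in>carrier K. f' (p k) = f k)"
    if f: "nontrivial_hom K T f" for f
  proof -
    have fh: "f \<in> hom K T" using f by (simp add: nontrivial_hom_def)
    obtain f' where f': "f' \<in> hom Q T" "\<And>k. k \<in> carrier K \<Longrightarrow> f' (p k) = f k"
      using hom_through_epi[OF assms(1-3) p fh ker[OF fh]] by blast
    then have "nontrivial_hom Q T f'"
      using f pc unfolding nontrivial_hom_def by metis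
    then show ?thesis using f'(2) by blast
  qed
  show ?thesis
  proof
    assume u: "unique_nontrivial_hom K T"
    show "unique_nontrivial_hom Q T"
      unfolding unique_nontrivial_hom_def
    proof (intro conjI allI impI)
      show "\<exists>f. nontrivial_hom Q T f" using u factor unfolding unique_nontrivial_hom_def by blast
      fix f g q assume fgq: "nontrivial_hom Q T f \<and> nontrivial_hom Q T g \<and> q \<in> carrier Q"
      then obtain k where k: "k \<in> carrier K" "q = p k" using surj by blast
      have "(f \<circ> p) k = (g \<circ> p) k"
        using u fgq k nontrivial_hom_comp_epi[OF p] unfolding unique_nontrivial_hom_def by blast
      then show "f q = g q" using k by simp
    qed
  next
    assume u: "unique_nontrivial_hom Q T"
    show "unique_nontrivial_hom K T"
      unfolding unique_nontrivial_hom_def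
    proof (intro conjI allI impI)
      show "\<exists>f. nontrivial_hom K T f"
        using u nontrivial_hom_comp_epi[OF p] unfolding unique_nontrivial_hom_def by blast
      fix f g k assume fgk: "nontrivial_hom K T f \<and> nontrivial_hom K T g \<and> k \<in> carrier K"
      obtain f' g' where "nontrivial_hom Q T f'" "\<forall>k\<in>carrier K. f' (p k) = f k"
        "nontrivial_hom Q T g'" "\<forall>k\<in>carrier K. g' (p k) = g k"
        using factor fgk by blast
      moreover from this have "f' (p k) = g' (p k)"
        using u pc fgk unfolding unique_nontrivial_hom_def by blast
      ultimately show "f k = g k" using fgk by simp
    qed
  qed
qed

lemma unique_nontrivial_hom_abelianization:
  assumes "group K" "comm_group T"
  shows "unique_nontrivial_hom K T \<longleftrightarrow> unique_nontrivial_hom (abelianization K) T"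
proof -
  interpret K: group K by fact
  interpret T: comm_group T by fact
  let ?D = "derived K (carrier K)"
  interpret D: normal ?D K by (rule K.derived_self_is_normal)
  have epi: "(\<lambda>x. ?D #>\<^bsub>K\<^esub> x) \<in> epi K (abelianization K)"
    using D.r_coset_hom_Mod by (auto simp: epi_def abelianization_def FactGroup_def RCOSETS_def)
  show ?thesis
  proof (rule unique_nontrivial_hom_epi[OF assms(1) _ T.is_group epi])
    show "group (abelianization K)"
      unfolding abelianization_def by (rule K.derived_quot_is_group)
    fix f x assume f: "f \<in> hom K T" and x: "x \<in> carrier K"
      and 1: "?D #>\<^bsub>K\<^esub> x = \<one>\<^bsub>abelianization K\<^esub>"
    interpret f: group_hom K T f using f by unfold_locales
    have "?D #>\<^bsub>K\<^esub> x = ?D" using 1 by (simp add: abelianization_def FactGroup_def)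
    then have "x \<in> ?D" using K.coset_join1[OF _ x D.subgroup_axioms] D.subset by blast
    moreover have "?D \<subseteq> kernel K T f"
      unfolding derived_def
    proof (rule K.generate_subgroup_incl[OF _ f.subgroup_kernel])
      have "f (a \<otimes>\<^bsub>K\<^esub> b \<otimes>\<^bsub>K\<^esub> inv\<^bsub>K\<^esub> a \<otimes>\<^bsub>K\<^esub> inv\<^bsub>K\<^esub> b) = \<one>\<^bsub>T\<^esub>"
        if ab: "a \<in> carrier K" "b \<in> carrier K" for a b
      proof -
        have "f (a \<otimes>\<^bsub>K\<^esub> b \<otimes>\<^bsub>K\<^esub> inv\<^bsub>K\<^esub> a \<otimes>\<^bsub>K\<^esub> inv\<^bsub>K\<^esub> b) = f b \<otimes>\<^bsub>T\<^esub> f a \<otimes>\<^bsub>T\<^esub> inv\<^bsub>T\<^esub> f a \<otimes>\<^bsub>T\<^esub> inv\<^bsub>T\<^esub> f b"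
          using ab T.m_comm[of "f a" "f b"] by simp
        also have "\<dots> = \<one>\<^bsub>T\<^esub>" using ab by (simp add: T.m_assoc T.inv_cancel)
        finally show ?thesis .
      qed
      then show "derived_set K (carrier K) \<subseteq> kernel K T f" by (auto simp: kernel_def)
    qed
    ultimately show "f x = \<one>\<^bsub>T\<^esub>" by (auto simp: kernel_def)
  qed
qed

lemma nontrivial_hom_iso_comp:
  assumes "group U" "group V" "g \<in> iso U V" "nontrivial_hom K U f"
  shows "nontrivial_hom K V (g \<circ> f)"
proof -
  have g: "g \<in> hom U V" "inj_on g (carrier U)" using assms(3) by (auto simp: iso_def bij_betw_def)
  interpret g: group_hom U V g using assms(1,2) g(1) by (simp add: group_hom_def group_hom_axioms_def)
  have f: "f \<in> hom K U" using assms(4) by (simp add: nontrivial_hom_def)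
  obtain k where k: "k \<in> carrier K" "f k \<noteq> \<one>\<^bsub>U\<^esub>" using assms(4) by (auto simp: nontrivial_hom_def)
  have "g (f k) \<noteq> \<one>\<^bsub>V\<^esub>"
    using k hom_in_carrier[OF f k(1)] g(2) g.inj_on_one_iff by blast
  moreover have "g \<circ> f \<in> hom K V"
    using hom_in_carrier[OF f] hom_mult[OF f] by (intro homI) auto
  ultimately show ?thesis using k(1) by (auto simp: nontrivial_hom_def)
qed

lemma unique_nontrivial_hom_target_iso:
  assumes "group A" "group B" "A \<cong> B" "unique_nontrivial_hom K A"
  shows "unique_nontrivial_hom K B"
proof -
  obtain h where h: "h \<in> iso A B" using assms(3) by (auto simp: is_iso_def)
  define h' where "h' = inv_into (carrier A) h"
  have h': "h' \<in> iso B A" unfolding h'_def by (rule group.iso_set_sym[OF assms(1) h])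
  have hh: "h (h' y) = y" if "y \<in> carrier B" for y
    using h that by (auto simp: h'_def iso_def bij_betw_def f_inv_into_f)
  show ?thesis
    unfolding unique_nontrivial_hom_def
  proof (intro conjI allI impI)
    show "\<exists>f. nontrivial_hom K B f"
      using assms(4) nontrivial_hom_iso_comp[OF assms(1,2) h] unfolding unique_nontrivial_hom_def by blast
    fix f g k assume fgk: "nontrivial_hom K B f \<and> nontrivial_hom K B g \<and> k \<in> carrier K"
    then have "(h' \<circ> f) k = (h' \<circ> g) k"
      using assms(4) nontrivial_hom_iso_comp[OF assms(2,1) h'] unfolding unique_nontrivial_hom_def by blast
    then have "h (h' (f k)) = h (h' (g k))" by simp
    moreover have "f k \<in> carrier B" "g k \<in> carrier B"
      using fgk unfolding nontrivial_hom_def by (blast intro: hom_in_carrier)+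
    ultimately show "f k = g k" by (simp add: hh)
  qed
qed

lemma (in group) int_nat_pow_pow:
  assumes "x \<in> carrier G" shows "(x [^] (i::int)) [^] (k::nat) = x [^] (i * int k)"
  using assms by (simp add: int_pow_pow flip: int_pow_int)

text \<open>
Let the order be \<open>2\<^sup>m n\<close> with \<open>n\<close> odd, and \<open>P\<close> a Sylow 2-subgroup. Raising to the power \<open>n\<close> maps
\<open>Q\<close> into \<open>P\<close> and does not change the value of a homomorphism to a group of order two, so only the values on \<open>P\<close> matter.

If \<open>P\<close> is generated by \<open>x\<close>, a nontrivial homomorphism must be 1 on \<open>x\<close>, and one exists because a
character can be made odd on \<open>x\<close>. Conversely let \<open>f\<close> be the only nontrivial homomorphism and
\<open>x\<close> in \<open>P\<close> with \<open>f x = 1\<close>. No nontrivial homomorphism kills \<open>x\<close>, so \<open>x\<close> and the squares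
generate \<open>Q\<close>. Iterating, \<open>x\<close> and the \<open>2\<^sup>m\<close>-th powers generate \<open>Q\<close>, which forces \<open>x\<close> to
generate \<open>P\<close>.
\<close>

theorem unique_hom_Z2_iff_cyclic_Sylow:
  assumes "comm_group Q" "finite (carrier Q)"
  shows "unique_nontrivial_hom Q (integer_mod_group 2) \<longleftrightarrow>
    (\<exists>P. sylow_subgroup 2 P Q \<and> cyclic_group (Q\<lparr>carrier := P\<rparr>) \<and> \<not> trivial_group (Q\<lparr>carrier := P\<rparr>))"
proof -
  interpret Q: comm_group Q by fact
  let ?Z = "integer_mod_group 2"
  interpret Z: group ?Z by simp
  have oQ: "0 < order Q" using assms(2) by (simp add: Q.order_gt_0_iff_finite)
  define m where "m = multiplicity 2 (order Q)"
  obtain n where n: "order Q = 2 ^ m * n" "odd n"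
    using multiplicity_decompose'[of "order Q" 2] oQ unfolding m_def by (metis not_prime_unit not_gr0 two_is_prime_nat)
  have pow_n: "f (q [^]\<^bsub>Q\<^esub> n) = f q" if f: "f \<in> hom Q ?Z" and q: "q \<in> carrier Q" for f q
  proof -
    interpret f: group_hom Q ?Z f using f by unfold_locales
    have "f (q [^]\<^bsub>Q\<^esub> n) = (int n * f q) mod 2" using q by (simp add: f.hom_nat_pow)
    also have "\<dots> = f q"
    proof -
      have "int n mod 2 = 1" using n(2) by presburger
      then show ?thesis using hom_Z2_cases[OF f q] by auto
    qed
    finally show ?thesis .
  qed
  have int_pow: "f (q [^]\<^bsub>Q\<^esub> j) = (j * f q) mod 2" if f: "f \<in> hom Q ?Z" and q: "q \<in> carrier Q" for f q and j :: int
  proof -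
    interpret f: group_hom Q ?Z f using f by unfold_locales
    show ?thesis using q by (simp add: f.hom_int_pow int_pow_integer_mod_group)
  qed
  have in_P: "q [^]\<^bsub>Q\<^esub> n \<in> P" if P: "subgroup P Q" "card P = 2 ^ m" and q: "q \<in> carrier Q" for P q
  proof -
    interpret N: normal P Q using Q.subgroup_imp_normal[OF P(1)] .
    interpret M: group "Q Mod P" by (rule N.factorgroup_is_group)
    interpret pi: group_hom Q "Q Mod P" "\<lambda>x. P #>\<^bsub>Q\<^esub> x"
      using N.r_coset_hom_Mod by unfold_locales
    have "order (Q Mod P) * card P = order Q"
      using Q.lagrange[OF P(1)] by (simp add: FactGroup_def order_def)
    then have "order (Q Mod P) = n" using n(1) P(2) by simp
    then have "P #>\<^bsub>Q\<^esub> (q [^]\<^bsub>Q\<^esub> n) = \<one>\<^bsub>Q Mod P\<^esub>"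
      using q M.pow_order_eq_1[OF pi.hom_closed[OF q]] by (simp add: pi.hom_nat_pow)
    then show ?thesis
      using Q.coset_join1[OF _ _ P(1), of "q [^]\<^bsub>Q\<^esub> n"] q N.subset by (simp add: FactGroup_def)
  qed
  show ?thesis
  proof
    assume u: "unique_nontrivial_hom Q ?Z"
    then obtain f where f: "nontrivial_hom Q ?Z f" by (auto simp: unique_nontrivial_hom_def)
    then have fh: "f \<in> hom Q ?Z" by (simp add: nontrivial_hom_def)
    interpret f: group_hom Q ?Z f using fh by unfold_locales
    obtain P where P: "subgroup P Q" "card P = 2 ^ m"
      using sylow_thm[OF _ Q.is_group n(1) assms(2)] by auto
    interpret P: subgroup P Q by fact
    obtain q where q: "q \<in> carrier Q" "f q \<noteq> 0" using f by (auto simp: nontrivial_hom_def)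
    define x where "x = q [^]\<^bsub>Q\<^esub> n"
    have xP: "x \<in> P" unfolding x_def by (rule in_P[OF P q(1)])
    have x: "x \<in> carrier Q" using xP by (rule P.mem_carrier)
    have fx: "f x \<noteq> 0" using pow_n[OF fh q(1)] q(2) by (simp add: x_def)
    \<comment> \<open>the subgroup \<open>\<langle>x\<rangle> Q\<^sup>2\<close>\<close>
    define S where "S = {x [^]\<^bsub>Q\<^esub> (j::int) \<otimes>\<^bsub>Q\<^esub> r [^]\<^bsub>Q\<^esub> (2::nat) | j r. r \<in> carrier Q}"
    have SI: "x [^]\<^bsub>Q\<^esub> (j::int) \<otimes>\<^bsub>Q\<^esub> r [^]\<^bsub>Q\<^esub> (2::nat) \<in> S" if "r \<in> carrier Q" for j r
      using that unfolding S_def by blast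
    have S: "subgroup S Q"
    proof (rule Q.subgroupI)
      show "S \<subseteq> carrier Q" using x by (auto simp: S_def)
      show "S \<noteq> {}" using SI[OF Q.one_closed] by blast
      fix a assume "a \<in> S"
      then obtain i r where a: "a = x [^]\<^bsub>Q\<^esub> (i::int) \<otimes>\<^bsub>Q\<^esub> r [^]\<^bsub>Q\<^esub> (2::nat)" "r \<in> carrier Q"
        unfolding S_def by blast
      have "inv\<^bsub>Q\<^esub> a = x [^]\<^bsub>Q\<^esub> (- i) \<otimes>\<^bsub>Q\<^esub> (inv\<^bsub>Q\<^esub> r) [^]\<^bsub>Q\<^esub> (2::nat)"
        using x a(2) by (simp add: a(1) Q.inv_mult Q.int_pow_neg Q.nat_pow_inv)
      then show "inv\<^bsub>Q\<^esub> a \<in> S" using SI[of "inv\<^bsub>Q\<^esub> r" "- i"] a(2) by simp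
      fix b assume "b \<in> S"
      then obtain j s where b: "b = x [^]\<^bsub>Q\<^esub> (j::int) \<otimes>\<^bsub>Q\<^esub> s [^]\<^bsub>Q\<^esub> (2::nat)" "s \<in> carrier Q"
        unfolding S_def by blast
      have "a \<otimes>\<^bsub>Q\<^esub> b = (x [^]\<^bsub>Q\<^esub> i \<otimes>\<^bsub>Q\<^esub> x [^]\<^bsub>Q\<^esub> j) \<otimes>\<^bsub>Q\<^esub> (r [^]\<^bsub>Q\<^esub> (2::nat) \<otimes>\<^bsub>Q\<^esub> s [^]\<^bsub>Q\<^esub> (2::nat))"
        unfolding a(1) b(1) by (rule Q.mult_swap) (use x a(2) b(2) in auto)
      also have "\<dots> = x [^]\<^bsub>Q\<^esub> (i + j) \<otimes>\<^bsub>Q\<^esub> (r \<otimes>\<^bsub>Q\<^esub> s) [^]\<^bsub>Q\<^esub> (2::nat)"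
        using x a(2) b(2) Q.nat_pow_mult_distrib[OF a(2) b(2)] by (simp add: Q.int_pow_mult)
      finally show "a \<otimes>\<^bsub>Q\<^esub> b \<in> S" using SI[of "r \<otimes>\<^bsub>Q\<^esub> s" "i + j"] a(2) b(2) by simp
    qed
    have sq: "a [^]\<^bsub>Q\<^esub> (2::nat) \<in> S" if "a \<in> carrier Q" for a
      using SI[OF that, of 0] that by simp
    have xS: "x \<in> S" using SI[OF Q.one_closed, of 1] x by simp
    have "y \<in> S" if y: "y \<in> carrier Q" for y
    proof (rule ccontr)
      assume "y \<notin> S"
      obtain k where k: "0 < k" "y [^]\<^bsub>Q\<^esub> (k::nat) \<in> S" "\<And>j::int. y [^]\<^bsub>Q\<^esub> j \<in> S \<Longrightarrow> int k dvd j"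
        using Q.relative_order[OF S y _ sq[OF y]] by auto
      obtain chi where chi: "chi \<in> hom Q ?Z" "\<And>s. s \<in> S \<Longrightarrow> chi s = 0" "chi y = int (2 div k) mod int 2"
        using separating_character[OF assms(1,2) S _ sq y k(2,3)] by auto
      have "k \<noteq> 1" using k(2) y \<open>y \<notin> S\<close> by auto
      moreover have "int k dvd int 2"
      proof (rule k(3))
        show "y [^]\<^bsub>Q\<^esub> int 2 \<in> S" using sq[OF y] by (simp only: int_pow_int)
      qed
      then have "k dvd 2" by presburger
      ultimately have "k = 2" using prime_nat_iff[of 2] two_is_prime_nat by auto
      then have "chi y \<noteq> 0" using chi(3) by simp
      then have "nontrivial_hom Q ?Z chi" using chi(1) y by (auto simp: nontrivial_hom_def)
      then have "f x = chi x" using u f x unfolding unique_nontrivial_hom_def by blast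
      then show False using chi(2)[OF xS] fx by simp
    qed
    then have step: "\<exists>j r. r \<in> carrier Q \<and> y = x [^]\<^bsub>Q\<^esub> (j::int) \<otimes>\<^bsub>Q\<^esub> r [^]\<^bsub>Q\<^esub> (2::nat)" if "y \<in> carrier Q" for y
      using that unfolding S_def by blast
    have iter: "\<exists>j r. r \<in> carrier Q \<and> y = x [^]\<^bsub>Q\<^esub> (j::int) \<otimes>\<^bsub>Q\<^esub> r [^]\<^bsub>Q\<^esub> ((2::nat) ^ l)" if "y \<in> carrier Q" for y l
    proof (induction l)
      case 0
      then show ?case using that by (intro exI[of _ 0] exI[of _ y]) simp
    next
      case (Suc l)
      then obtain j r where r: "r \<in> carrier Q" "y = x [^]\<^bsub>Q\<^esub> (j::int) \<otimes>\<^bsub>Q\<^esub> r [^]\<^bsub>Q\<^esub> ((2::nat) ^ l)" by blast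
      obtain i s where s: "s \<in> carrier Q" "r = x [^]\<^bsub>Q\<^esub> (i::int) \<otimes>\<^bsub>Q\<^esub> s [^]\<^bsub>Q\<^esub> (2::nat)"
        using step[OF r(1)] by blast
      have "r [^]\<^bsub>Q\<^esub> ((2::nat) ^ l) = x [^]\<^bsub>Q\<^esub> (i * 2 ^ l) \<otimes>\<^bsub>Q\<^esub> s [^]\<^bsub>Q\<^esub> ((2::nat) ^ Suc l)"
        using x s(1) by (simp add: s(2) Q.nat_pow_mult_distrib Q.nat_pow_pow Q.int_nat_pow_pow)
      then have "y = x [^]\<^bsub>Q\<^esub> (j + i * 2 ^ l) \<otimes>\<^bsub>Q\<^esub> s [^]\<^bsub>Q\<^esub> ((2::nat) ^ Suc l)"
        using x s(1) r(2) by (simp add: Q.int_pow_mult Q.m_assoc)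
      then show ?case using s(1) by blast
    qed
    have "y \<in> range (\<lambda>j::int. x [^]\<^bsub>Q\<^esub> j)" if yP: "y \<in> P" for y
    proof -
      have y: "y \<in> carrier Q" using yP by (rule P.mem_carrier)
      obtain j r where r: "r \<in> carrier Q" "y = x [^]\<^bsub>Q\<^esub> (j::int) \<otimes>\<^bsub>Q\<^esub> r [^]\<^bsub>Q\<^esub> ((2::nat) ^ m)"
        using iter[OF y] by blast
      have "r [^]\<^bsub>Q\<^esub> ((2::nat) ^ m * n) = \<one>\<^bsub>Q\<^esub>" using Q.pow_order_eq_1[OF r(1)] n(1) by simp
      then have yn: "y [^]\<^bsub>Q\<^esub> int n = x [^]\<^bsub>Q\<^esub> (j * int n)"
        using x r(1) by (simp add: r(2) int_pow_int Q.nat_pow_mult_distrib Q.nat_pow_pow Q.int_nat_pow_pow)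
      have "group (Q\<lparr>carrier := P\<rparr>)" using Q.subgroup_imp_group[OF P(1)] .
      then have "y [^]\<^bsub>Q\<^esub> (2 ^ m :: nat) = \<one>\<^bsub>Q\<^esub>"
        using group.pow_order_eq_1[of "Q\<lparr>carrier := P\<rparr>" y] yP P(2)
        by (simp add: order_def flip: Q.nat_pow_consistent)
      then have ym: "y [^]\<^bsub>Q\<^esub> int (2 ^ m) = \<one>\<^bsub>Q\<^esub>" by (simp only: int_pow_int)
      \<comment> \<open>\<open>y\<close> is a power of its \<open>n\<close>-th power, because its order divides \<open>2\<^sup>m\<close>\<close>
      have "coprime (int n) (int (2 ^ m))" using n(2) by simp
      then obtain u v where uv: "u * int n + v * int (2 ^ m) = 1"
        using bezout_int[of "int n" "int (2 ^ m)"] by (auto simp: coprime_iff_gcd_eq_1)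
      have "y = y [^]\<^bsub>Q\<^esub> (int n * u + int (2 ^ m) * v)" using uv y by (simp add: mult.commute)
      also have "\<dots> = (y [^]\<^bsub>Q\<^esub> int n) [^]\<^bsub>Q\<^esub> u \<otimes>\<^bsub>Q\<^esub> (y [^]\<^bsub>Q\<^esub> int (2 ^ m)) [^]\<^bsub>Q\<^esub> v"
        using y by (simp only: Q.int_pow_mult Q.int_pow_pow)
      also have "\<dots> = x [^]\<^bsub>Q\<^esub> (j * int n * u)"
        unfolding yn ym using x by (simp add: Q.int_pow_pow)
      finally show ?thesis by (rule range_eqI)
    qed
    moreover have "x [^]\<^bsub>Q\<^esub> (j::int) \<in> P" for j using Q.subgroup_int_pow_closed[OF P(1) xP] .
    ultimately have gen: "P = range (\<lambda>j::int. x [^]\<^bsub>Q\<^esub> j)" by blast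
    have gP: "group (Q\<lparr>carrier := P\<rparr>)" using Q.subgroup_imp_group[OF P(1)] .
    have pow_eq: "x [^]\<^bsub>Q\<lparr>carrier := P\<rparr>\<^esub> j = x [^]\<^bsub>Q\<^esub> j" for j :: int
      using Q.int_pow_consistent[OF P(1) xP] by simp
    have "carrier (Q\<lparr>carrier := P\<rparr>) = range (\<lambda>j::int. x [^]\<^bsub>Q\<lparr>carrier := P\<rparr>\<^esub> j)"
      unfolding pow_eq gen[symmetric] by simp
    then have "cyclic_group (Q\<lparr>carrier := P\<rparr>)"
      unfolding group.cyclic_group[OF gP] using xP by (intro bexI[of _ x]) simp_all
    moreover have "x \<noteq> \<one>\<^bsub>Q\<^esub>" using fx f.hom_one by auto
    then have "\<not> trivial_group (Q\<lparr>carrier := P\<rparr>)" using xP by (auto simp: trivial_group_def)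
    moreover have "sylow_subgroup 2 P Q" using P by (simp add: sylow_subgroup_def m_def)
    ultimately show "\<exists>P. sylow_subgroup 2 P Q \<and> cyclic_group (Q\<lparr>carrier := P\<rparr>) \<and> \<not> trivial_group (Q\<lparr>carrier := P\<rparr>)"
      by blast
  next
    assume "\<exists>P. sylow_subgroup 2 P Q \<and> cyclic_group (Q\<lparr>carrier := P\<rparr>) \<and> \<not> trivial_group (Q\<lparr>carrier := P\<rparr>)"
    then obtain P where P: "subgroup P Q" "card P = 2 ^ m" and cyc: "cyclic_group (Q\<lparr>carrier := P\<rparr>)"
      and nt: "\<not> trivial_group (Q\<lparr>carrier := P\<rparr>)" by (auto simp: sylow_subgroup_def m_def)
    interpret P: subgroup P Q by fact
    have gP: "group (Q\<lparr>carrier := P\<rparr>)" using Q.subgroup_imp_group[OF P(1)] .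
    obtain x where xP: "x \<in> P" and gen': "P = range (\<lambda>j::int. x [^]\<^bsub>Q\<lparr>carrier := P\<rparr>\<^esub> j)"
      using cyc unfolding group.cyclic_group[OF gP] by auto
    have gen: "P = range (\<lambda>j::int. x [^]\<^bsub>Q\<^esub> j)"
      using gen' unfolding Q.int_pow_consistent[OF P(1) xP, symmetric] .
    have x: "x \<in> carrier Q" using xP by (rule P.mem_carrier)
    have ordx: "Q.ord x = 2 ^ m"
    proof -
      have "generate Q {x} = P" unfolding gen Q.generate_pow[OF x] by blast
      then show ?thesis using Q.generate_pow_card[OF x] P(2) by simp
    qed
    have m0: "m \<noteq> 0"
    proof
      assume "m = 0"
      then have "card P = 1" using P(2) by simp
      then have "P = {\<one>\<^bsub>Q\<^esub>}" using P.one_closed by (metis card_1_singletonE singletonD)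
      then show False using nt gP by (simp add: trivial_group_def)
    qed
    have val: "f q = j mod 2"
      if f: "nontrivial_hom Q ?Z f" and q: "q \<in> carrier Q" and j: "q [^]\<^bsub>Q\<^esub> n = x [^]\<^bsub>Q\<^esub> (j::int)" for f q j
    proof -
      have fh: "f \<in> hom Q ?Z" using f by (simp add: nontrivial_hom_def)
      have eq: "f r = (i * f x) mod 2" if "r \<in> carrier Q" "r [^]\<^bsub>Q\<^esub> n = x [^]\<^bsub>Q\<^esub> (i::int)" for r i
        using pow_n[OF fh that(1)] int_pow[OF fh x, of i] that(2) by simp
      have "f x \<noteq> 0"
      proof
        assume 0: "f x = 0"
        obtain r where r: "r \<in> carrier Q" "f r \<noteq> 0" using f by (auto simp: nontrivial_hom_def)
        obtain i where ri: "r [^]\<^bsub>Q\<^esub> n = x [^]\<^bsub>Q\<^esub> (i::int)" using in_P[OF P r(1)] unfolding gen by blast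
        show False using eq[OF r(1) ri] r(2) 0 by simp
      qed
      then have "f x = 1" using hom_Z2_cases[OF fh x] by simp
      then show ?thesis using eq[OF q j] by simp
    qed
    show "unique_nontrivial_hom Q ?Z"
      unfolding unique_nontrivial_hom_def
    proof (intro conjI allI impI)
      fix f g q assume fgq: "nontrivial_hom Q ?Z f \<and> nontrivial_hom Q ?Z g \<and> q \<in> carrier Q"
      then obtain j where "q [^]\<^bsub>Q\<^esub> n = x [^]\<^bsub>Q\<^esub> (j::int)" using in_P[OF P] unfolding gen by blast
      then show "f q = g q" using val[of f q j] val[of g q j] fgq by simp
    next
      define e where "e = order Q"
      have e: "0 < e" "even e" using oQ n(1) m0 by (simp_all add: e_def)
      have x_pow: "x [^]\<^bsub>Q\<^esub> (2 ^ m :: nat) \<in> {\<one>\<^bsub>Q\<^esub>}" using Q.pow_ord_eq_1[OF x] by (simp add: ordx)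
      have x_ord: "int (2 ^ m) dvd j" if "x [^]\<^bsub>Q\<^esub> (j::int) \<in> {\<one>\<^bsub>Q\<^esub>}" for j
        using that Q.int_pow_eq_id[OF x, of j] by (simp add: ordx)
      have e_pow: "a [^]\<^bsub>Q\<^esub> e \<in> {\<one>\<^bsub>Q\<^esub>}" if "a \<in> carrier Q" for a
        using Q.pow_order_eq_1[OF that] by (simp add: e_def)
      obtain chi where chi: "chi \<in> hom Q (integer_mod_group e)" "chi x = int (e div 2 ^ m) mod int e"
        using separating_character[OF assms(1,2) Q.triv_subgroup e(1) e_pow x x_pow x_ord] by blast
      \<comment> \<open>reduction modulo 2 is well defined on residues modulo the even number \<open>e\<close>\<close>
      have mod: "(a mod int e) mod 2 = a mod 2" for a using e(2) by (simp add: mod_mod_cancel)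
      have "(\<lambda>q. chi q mod 2) \<in> hom Q ?Z"
      proof (rule homI)
        fix a b assume "a \<in> carrier Q" "b \<in> carrier Q"
        then show "chi (a \<otimes>\<^bsub>Q\<^esub> b) mod 2 = (chi a mod 2) \<otimes>\<^bsub>?Z\<^esub> (chi b mod 2)"
          using hom_mult[OF chi(1)] by (simp add: mod mod_add_eq)
      qed (auto simp: carrier_Z2)
      moreover have "chi x mod 2 \<noteq> 0"
      proof -
        have "e div 2 ^ m = n" using n(1) by (simp add: e_def)
        then show ?thesis using n(2) by (simp add: chi(2) mod) presburger
      qed
      ultimately show "\<exists>f. nontrivial_hom Q ?Z f" using x unfolding nontrivial_hom_def by force
    qed
  qed
qed

section \<open>The classification\<close>

theorem theorem3p5:
  fixes A :: "'a monoid" and G :: "'g monoid" and K :: "'k monoid"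
    and i :: "'a \<Rightarrow> 'g" and p :: "'g \<Rightarrow> 'k"
  assumes "finite (carrier A)" and "finite (carrier G)" and "finite (carrier K)"
    and "central_extension A G K i p"
    and "\<not> trivial_group A"
    and "centerless K"
  shows "stable_group G \<longleftrightarrow>
    G \<cong> integer_mod_group 2 \<times>\<times> K \<and>
    complete_group K \<and>
    (\<exists>P. sylow_subgroup 2 P (abelianization K) \<and>
         cyclic_group ((abelianization K)\<lparr>carrier := P\<rparr>) \<and>
         \<not> trivial_group ((abelianization K)\<lparr>carrier := P\<rparr>))"
proof -
  have grp: "group A" "group G" "group K" and i: "i \<in> mon A G" and p: "p \<in> epi G K"
    and exact: "i ` carrier A = kernel G K p" and central: "i ` carrier A \<subseteq> center G"
    using assms(4) by (auto simp: central_extension_def)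
  interpret A: group A by fact
  interpret G: group G by fact
  interpret K: group K by fact
  let ?Z = "integer_mod_group 2"
  have Z: "group ?Z" by simp
  have Z2K: "group (?Z \<times>\<times> K)" using Z grp(3) by (rule DirProd_group)
  have hom_iff: "unique_nontrivial_hom K ?Z \<longleftrightarrow> (\<exists>P. sylow_subgroup 2 P (abelianization K) \<and>
         cyclic_group ((abelianization K)\<lparr>carrier := P\<rparr>) \<and>
         \<not> trivial_group ((abelianization K)\<lparr>carrier := P\<rparr>))"
  proof -
    have "comm_group (abelianization K)"
      unfolding abelianization_def by (rule K.derived_quot_is_comm_group)
    moreover have "finite (carrier (abelianization K))"
      using assms(3) by (simp add: abelianization_def FactGroup_def RCOSETS_def)
    ultimately show ?thesis
      unfolding unique_nontrivial_hom_abelianization[OF grp(3) abelian_integer_mod_group]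
      by (rule unique_hom_Z2_iff_cyclic_Sylow)
  qed
  show ?thesis
    unfolding hom_iff[symmetric]
  proof
    assume stable: "stable_group G"
    then obtain theta where theta: "theta \<in> iso G (AutoGroup G)"
      by (auto simp: stable_group_def is_iso_def)
    have center: "kernel G K p = center G"
    proof
      show "kernel G K p \<subseteq> center G" using exact central by simp
      show "center G \<subseteq> kernel G K p"
        using epi_image_center[OF p] assms(6) center_carrier by (fastforce simp: kernel_def centerless_def)
    qed
    interpret S: stable_central_cover G K p theta
      by (intro stable_central_cover.intro stable_central_cover_axioms.intro
          grp assms(2,6) p center theta)
    have i_iso: "i \<in> iso A (G\<lparr>carrier := center G\<rparr>)"
      using i exact center by (auto simp: mon_def iso_def bij_betw_def hom_def)
    have centerG: "group (G\<lparr>carrier := center G\<rparr>)"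
      by (rule G.subgroup_imp_group[OF G.center_subgroup])
    have A_comm: "comm_group A"
    proof (rule A.group_comm_groupI)
      fix x y assume xy: "x \<in> carrier A" "y \<in> carrier A"
      have hom: "i \<in> hom A G" and inj: "inj_on i (carrier A)" using i by (simp_all add: mon_def)
      have "i x \<in> center G" "i y \<in> carrier G" using central hom_in_carrier[OF hom] xy by auto
      then have "i (x \<otimes>\<^bsub>A\<^esub> y) = i (y \<otimes>\<^bsub>A\<^esub> x)"
        using hom_mult[OF hom xy] hom_mult[OF hom xy(2,1)] center_commutes by metis
      then show "x \<otimes>\<^bsub>A\<^esub> y = y \<otimes>\<^bsub>A\<^esub> x" using inj xy by (meson A.m_closed inj_onD)
    qed
    have AK: "group (A \<times>\<times> K)" using grp(1,3) by (rule DirProd_group)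
    have "A \<times>\<times> K \<cong> G\<lparr>carrier := center G\<rparr> \<times>\<times> K"
      by (rule group.DirProd_iso_trans[OF grp(1)]) (use i_iso in \<open>auto simp: is_iso_def intro: iso_refl\<close>)
    also have "G\<lparr>carrier := center G\<rparr> \<times>\<times> K \<cong> AutoGroup G"
      using S.automorphism_decomposition unfolding is_iso_def by blast
    also (iso_trans) have "AutoGroup G \<cong> G"
      using group.iso_sym[OF grp(2)] stable by (simp add: stable_group_def)
    finally (iso_trans) have AK_G: "A \<times>\<times> K \<cong> G" .
    have G_AK: "G \<cong> A \<times>\<times> K" by (rule group.iso_sym[OF AK AK_G])
    have "stable_group (A \<times>\<times> K)" by (rule stable_group_iso[OF grp(2) AK G_AK stable])
    then obtain theta' where theta': "theta' \<in> iso (A \<times>\<times> K) (AutoGroup (A \<times>\<times> K))"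
      by (auto simp: stable_group_def is_iso_def)
    interpret P: stable_product A K theta'
    proof (intro stable_product.intro stable_product_axioms.intro A_comm grp assms(1,3,6) theta')
      show "carrier A \<noteq> {\<one>\<^bsub>A\<^esub>}" using assms(5) grp(1) by (simp add: trivial_group_def)
    qed
    have "A \<times>\<times> K \<cong> ?Z \<times>\<times> K"
      by (rule group.DirProd_iso_trans[OF grp(1) P.A_iso_Z2 iso_refl])
    with G_AK have "G \<cong> ?Z \<times>\<times> K" by (rule iso_trans)
    moreover have "unique_nontrivial_hom K ?Z"
      by (rule unique_nontrivial_hom_target_iso[OF grp(1) Z P.A_iso_Z2 P.unique_nontrivial_hom_K_A])
    ultimately show "G \<cong> ?Z \<times>\<times> K \<and> complete_group K \<and> unique_nontrivial_hom K ?Z"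
      using P.complete_K by blast
  next
    assume *: "G \<cong> ?Z \<times>\<times> K \<and> complete_group K \<and> unique_nontrivial_hom K ?Z"
    then have "stable_group (?Z \<times>\<times> K)"
      by (intro stable_Z2_product grp assms(6)) simp_all
    moreover have "?Z \<times>\<times> K \<cong> G" using group.iso_sym[OF grp(2)] * by blast
    ultimately show "stable_group G" using stable_group_iso[OF Z2K grp(2)] by blast
  qed
qed

end
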